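(* Let $\kappa$ be a sublinear function. Let $(G,Y,X)$ and $(G,Y',X')$ be two hyperbolic projections such that $X\sim X'$, and let $\Psi:Y\to Y'$ be a coarsely $G$-equivariant quasi-isometry. Then $(G,Y,X)$ is $\kappa$-injective if and only if $(G,Y',X')$ is $\kappa$-injective. Furthermore, if they are $\kappa$-injective, then the induced bijection $\partial\Psi:\partial_\kappa Y\to\partial_\kappa Y'$ is a homeomorphism with respect to the topologies $\mathcal T(G,Y,X)$ on $\partial_\kappa Y$ and $\mathcal T(G,Y',X')$ on $\partial_\kappa Y'$.
   Context: **Coarse maps.** A map $f$ is coarsely Lipschitz if $d(f(x),f(y))\le Kd(x,y)+C$ for constants $K\ge 1,C\ge 0$; a $(K,C)$-quasi-isometric embedding if also $d(f(x),f(y))\ge\frac1Kd(x,y)-C$; a quasi-isometry if moreover its image is coarsely dense. A quasi-geodesic is a quasi-isometric embedding of an interval. For isometric $G$-actions, $f$ is coarsely $G$-equivariant if $d(f(gy),gf(y))\le C$ for a uniform $C$. All actions are isometric; geometric means properly discontinuous and cocompact. **$\kappa$-Morse boundary.** The function $\kappa:[0,\infty)\to[0,\infty)$ is monotone increasing (constants allowed), concave, with $\lim_{t\to\infty}\kappa(t)/t=0$. For $Y$ with basepoint $o$ put $\kappa(y):=\kappa(d(o,y))$ and $\mathcal N_\kappa(Z,n)=\{y: d(y,Z)\le n\kappa(y)\}$ for closed $Z\subset Y$. Two quasi-geodesic rays are $\kappa$-close ($\kappa$-fellow travel) if each is contained in some $\mathcal N_\kappa(\cdot,n)$ of the other. $Z\subseteq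 Y$ is $\kappa$-Morse if there is $\mu_Z:\mathbb R_+^2\to\mathbb R_+$ such that every $(K,C)$-quasi-geodesic segment $\beta$ with endpoints on $Z$ is contained in $\mathcal N_\kappa(Z,\mu_Z(K,C))$. $\partial_\kappa Y$ is the set of $\kappa$-Morse quasi-geodesic rays modulo $\kappa$-fellow travelling. A quasi-isometry $\Psi$ between proper geodesic spaces induces a bijection $\partial\Psi:[\gamma]\mapsto[\Psi\circ\gamma]$ of $\kappa$-boundaries. **Hyperbolic spaces (not necessarily geodesic or proper).** $(x\mid y)_o=\frac12(d(o,x)+d(o,y)-d(x,y))$. $X$ is $\delta$-hyperbolic if $(x\mid y)_o\ge\min\{(x\mid z)_o,(z\mid y)_o\}-\delta$ for all $x,y,z,o$. A sequence $(x_i)$ converges to infinity if $(x_i\mid x_j)_o\to\infty$ as $i,j\to\infty$; two such sequences are equivalent if $(x_i\mid y_i)_o\to\infty$; $\partial_\infty X$ is the set of equivalence classes. For $\xi,\eta\in\partial_\infty X$, $(\xi\mid\eta)_o=\inf\liminf_i(x_i\mid y_i)_o$ over representatives. The visual topology has neighbourhood bases $\{\eta:(\xi\mid\eta)_o>R\}$, $R\ge0$. A map $\gamma:[a,\infty)\to X$ (not necessarily continuous) defines the point $\xi\in\partial_\infty X$ if for every increasing sequence $t_i\to\infty$ the sequence $(\gamma(t_i))_i$ converges to infinity and represents $\xi$. **Quasi-rulings.** A (not necessarily continuous) path $\gamma:I\to X$ on a closed interval is an unparametrised $D$-quasi-ruler if (1) $d(\gamma(t),\gamma(s))+d(\gamma(s),\gamma(r))\le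 d(\gamma(t),\gamma(r))+D$ for all $t<s<r$ and (2) $\limsup_{|t-t_0|\to0}d(\gamma(t),\gamma(t_0))<D$ for all $t_0\in I$. $X$ admits a $D$-quasi-ruling if any two points of $X$ are joined by an unparametrised $D$-quasi-ruler. **Hyperbolic projections.** A hyperbolic projection $(G,Y,X)$ consists of a finitely generated group $G$, a geodesic metric space $Y$ with a geometric $G$-action, and a hyperbolic space $X$ admitting a $D$-quasi-ruling (for some $D$) with a cobounded isometric $G$-action. There is a coarsely $G$-equivariant coarsely Lipschitz map $p:Y\to X$, unique up to bounded distance (the induced projection map). Two cobounded actions are equivalent, $X\sim X'$, iff there is a coarsely $G$-equivariant quasi-isometry $X\to X'$. **$\kappa$-injectivity.** $(G,Y,X)$ is $\kappa$-injective if $p\circ\gamma$ defines a point of $\partial_\infty X$ for every $\kappa$-Morse quasi-geodesic ray $\gamma$ in $Y$, and two $\kappa$-Morse quasi-geodesic rays are $\kappa$-close if and only if their projections define the same point of $\partial_\infty X$. Then $\partial p:\partial_\kappa Y\hookrightarrow\partial_\infty X$, $[\gamma]\mapsto[p\circ\gamma]$, is well defined and injective, and $\mathcal T(G,Y,X)$ denotes the pull-back to $\partial_\kappa Y$ under $\partial p$ of the visual topology on $\partial_\infty X$.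
   Formalization: The homeomorphism part assumes κ(0)>0: if κ(0)=0, every κ-Morse ray must have the basepoint in its closure, so Ψ∘γ need not be κ-Morse (e.g. Ψ=id on a tree with different basepoints) and the induced map ∂Ψ is not defined. *)

theory Defs
  imports
    "HOL-Analysis.Analysis"
    "HOL-Algebra.Generated_Groups"
    "HOL-Algebra.Group_Action"
begin

section \<open>Coarse maps\<close>

definition coarsely_Lipschitz :: "('a::metric_space \<Rightarrow> 'b::metric_space) \<Rightarrow> bool" where
  "coarsely_Lipschitz f \<longleftrightarrow>
     (\<exists>K\<ge>1. \<exists>C\<ge>0. \<forall>x y. dist (f x) (f y) \<le> K * dist x y + C)"

definition qi_embedding_on ::
    "real \<Rightarrow> real \<Rightarrow> 'a::metric_space set \<Rightarrow> ('a \<Rightarrow> 'b::metric_space) \<Rightarrow> bool" where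
  "qi_embedding_on K C S f \<longleftrightarrow>
     K \<ge> 1 \<and> C \<ge> 0 \<and>
     (\<forall>x\<in>S. \<forall>y\<in>S. dist (f x) (f y) \<le> K * dist x y + C \<and>
                      dist (f x) (f y) \<ge> dist x y / K - C)"

definition coarsely_dense :: "'a::metric_space set \<Rightarrow> bool" where
  "coarsely_dense A \<longleftrightarrow> (\<exists>R. \<forall>x. \<exists>a\<in>A. dist x a \<le> R)"

definition quasi_isometry :: "('a::metric_space \<Rightarrow> 'b::metric_space) \<Rightarrow> bool" where
  "quasi_isometry f \<longleftrightarrow> (\<exists>K C. qi_embedding_on K C UNIV f) \<and> coarsely_dense (range f)"

text \<open>Quasi-geodesic segments and rays are maps on the real line of which only the values
  on the indicated interval matter.\<close>

definition quasi_geodesic_segment ::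
    "real \<Rightarrow> real \<Rightarrow> real \<Rightarrow> real \<Rightarrow> (real \<Rightarrow> 'a::metric_space) \<Rightarrow> bool" where
  "quasi_geodesic_segment K C a b \<beta> \<longleftrightarrow> a \<le> b \<and> qi_embedding_on K C {a..b} \<beta>"

definition quasi_geodesic_ray :: "(real \<Rightarrow> 'a::metric_space) \<Rightarrow> bool" where
  "quasi_geodesic_ray \<gamma> \<longleftrightarrow> (\<exists>K C. qi_embedding_on K C {0..} \<gamma>)"

definition geodesic_space :: "'a::metric_space itself \<Rightarrow> bool" where
  "geodesic_space _ \<longleftrightarrow>
     (\<forall>x y::'a. \<exists>\<gamma>::real \<Rightarrow> 'a. \<gamma> 0 = x \<and> \<gamma> (dist x y) = y \<and>
        (\<forall>s\<in>{0..dist x y}. \<forall>t\<in>{0..dist x y}. dist (\<gamma> s) (\<gamma> t) = \<bar>s - t\<bar>))"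


section \<open>Group actions\<close>

definition finitely_generated :: "('g, 'm) monoid_scheme \<Rightarrow> bool" where
  "finitely_generated G \<longleftrightarrow>
     (\<exists>S. finite S \<and> S \<subseteq> carrier G \<and> generate G S = carrier G)"

definition isometric_action ::
    "('g, 'm) monoid_scheme \<Rightarrow> ('g \<Rightarrow> 'a::metric_space \<Rightarrow> 'a) \<Rightarrow> bool" where
  "isometric_action G \<phi> \<longleftrightarrow> group_action G UNIV \<phi> \<and>
     (\<forall>g\<in>carrier G. \<forall>x y. dist (\<phi> g x) (\<phi> g y) = dist x y)"

definition properly_discontinuous ::
    "('g, 'm) monoid_scheme \<Rightarrow> ('g \<Rightarrow> 'a::metric_space \<Rightarrow> 'a) \<Rightarrow> bool" where
  "properly_discontinuous G \<phi> \<longleftrightarrow>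
     (\<forall>B. compact B \<longrightarrow> finite {g \<in> carrier G. \<phi> g ` B \<inter> B \<noteq> {}})"

definition cocompact ::
    "('g, 'm) monoid_scheme \<Rightarrow> ('g \<Rightarrow> 'a::metric_space \<Rightarrow> 'a) \<Rightarrow> bool" where
  "cocompact G \<phi> \<longleftrightarrow> (\<exists>B. compact B \<and> (\<Union>g\<in>carrier G. \<phi> g ` B) = UNIV)"

definition cobounded ::
    "('g, 'm) monoid_scheme \<Rightarrow> ('g \<Rightarrow> 'a::metric_space \<Rightarrow> 'a) \<Rightarrow> bool" where
  "cobounded G \<phi> \<longleftrightarrow> (\<exists>B. bounded B \<and> (\<Union>g\<in>carrier G. \<phi> g ` B) = UNIV)"

definition geometric_action ::
    "('g, 'm) monoid_scheme \<Rightarrow> ('g \<Rightarrow> 'a::metric_space \<Rightarrow> 'a) \<Rightarrow> bool" where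
  "geometric_action G \<phi> \<longleftrightarrow>
     isometric_action G \<phi> \<and> properly_discontinuous G \<phi> \<and> cocompact G \<phi>"

definition coarsely_equivariant ::
    "('g, 'm) monoid_scheme \<Rightarrow> ('g \<Rightarrow> 'a \<Rightarrow> 'a) \<Rightarrow> ('g \<Rightarrow> 'b \<Rightarrow> 'b) \<Rightarrow>
     ('a::metric_space \<Rightarrow> 'b::metric_space) \<Rightarrow> bool" where
  "coarsely_equivariant G \<phi> \<psi> f \<longleftrightarrow>
     (\<exists>C. \<forall>g\<in>carrier G. \<forall>x. dist (f (\<phi> g x)) (\<psi> g (f x)) \<le> C)"

definition equivalent_actions ::
    "('g, 'm) monoid_scheme \<Rightarrow> ('g \<Rightarrow> 'a::metric_space \<Rightarrow> 'a) \<Rightarrow>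
     ('g \<Rightarrow> 'b::metric_space \<Rightarrow> 'b) \<Rightarrow> bool" where
  "equivalent_actions G \<psi> \<psi>' \<longleftrightarrow>
     (\<exists>f. coarsely_equivariant G \<psi> \<psi>' f \<and> quasi_isometry f)"


section \<open>The \<open>\<kappa>\<close>-Morse boundary\<close>

text \<open>Only the values of \<open>\<kappa>\<close> on \<open>[0,\<infinity>)\<close> matter. Note that \<open>\<kappa>\<close> may vanish at \<open>0\<close>.\<close>

definition sublinear :: "(real \<Rightarrow> real) \<Rightarrow> bool" where
  "sublinear \<kappa> \<longleftrightarrow> (\<forall>t\<ge>0. 0 \<le> \<kappa> t) \<and> mono_on {0..} \<kappa> \<and> concave_on {0..} \<kappa> \<and>
     ((\<lambda>t. \<kappa> t / t) \<longlongrightarrow> 0) at_top"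

text \<open>As \<open>infdist y Z = infdist y (closure Z)\<close>, replacing \<open>Z\<close> by its closure makes no
  difference here, so \<open>Z\<close> is not required to be closed.\<close>

definition kappa_nbhd ::
    "(real \<Rightarrow> real) \<Rightarrow> 'a::metric_space \<Rightarrow> 'a set \<Rightarrow> real \<Rightarrow> 'a set" where
  "kappa_nbhd \<kappa> y0 Z n = {y. infdist y Z \<le> n * \<kappa> (dist y0 y)}"

definition kappa_Morse :: "(real \<Rightarrow> real) \<Rightarrow> 'a::metric_space \<Rightarrow> 'a set \<Rightarrow> bool" where
  "kappa_Morse \<kappa> y0 Z \<longleftrightarrow>
     (\<exists>\<mu>::real \<Rightarrow> real \<Rightarrow> real. \<forall>K\<ge>1. \<forall>C\<ge>0. \<mu> K C \<ge> 0 \<and>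
        (\<forall>a b \<beta>. quasi_geodesic_segment K C a b \<beta> \<and> \<beta> a \<in> Z \<and> \<beta> b \<in> Z \<longrightarrow>
           \<beta> ` {a..b} \<subseteq> kappa_nbhd \<kappa> y0 Z (\<mu> K C)))"

definition kappa_rays :: "(real \<Rightarrow> real) \<Rightarrow> 'a::metric_space \<Rightarrow> (real \<Rightarrow> 'a) set" where
  "kappa_rays \<kappa> y0 = {\<gamma>. quasi_geodesic_ray \<gamma> \<and> kappa_Morse \<kappa> y0 (\<gamma> ` {0..})}"

definition kappa_close ::
    "(real \<Rightarrow> real) \<Rightarrow> 'a::metric_space \<Rightarrow> (real \<Rightarrow> 'a) \<Rightarrow> (real \<Rightarrow> 'a) \<Rightarrow> bool" where
  "kappa_close \<kappa> y0 \<gamma> \<gamma>' \<longleftrightarrow>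
     (\<exists>n. \<gamma> ` {0..} \<subseteq> kappa_nbhd \<kappa> y0 (\<gamma>' ` {0..}) n) \<and>
     (\<exists>n. \<gamma>' ` {0..} \<subseteq> kappa_nbhd \<kappa> y0 (\<gamma> ` {0..}) n)"

definition kappa_boundary ::
    "(real \<Rightarrow> real) \<Rightarrow> 'a::metric_space \<Rightarrow> (real \<Rightarrow> 'a) set set" where
  "kappa_boundary \<kappa> y0 =
     kappa_rays \<kappa> y0 //
       {(\<gamma>, \<gamma>'). \<gamma> \<in> kappa_rays \<kappa> y0 \<and> \<gamma>' \<in> kappa_rays \<kappa> y0 \<and> kappa_close \<kappa> y0 \<gamma> \<gamma>'}"

text \<open>The map \<open>[\<gamma>] \<mapsto> [\<Psi> \<circ> \<gamma>]\<close> on \<open>\<kappa>\<close>-boundaries.\<close>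

definition kappa_boundary_map ::
    "(real \<Rightarrow> real) \<Rightarrow> 'b::metric_space \<Rightarrow> ('a \<Rightarrow> 'b) \<Rightarrow>
     (real \<Rightarrow> 'a::metric_space) set \<Rightarrow> (real \<Rightarrow> 'b) set" where
  "kappa_boundary_map \<kappa> y0' \<Psi> c =
     (THE c'. c' \<in> kappa_boundary \<kappa> y0' \<and> (\<forall>\<gamma>\<in>c. \<Psi> \<circ> \<gamma> \<in> c'))"


section \<open>Hyperbolic spaces and their boundary\<close>

definition gromov_product :: "'a::metric_space \<Rightarrow> 'a \<Rightarrow> 'a \<Rightarrow> real" where
  "gromov_product x0 x y = (dist x0 x + dist x0 y - dist x y) / 2"

definition hyperbolic_space :: "'a::metric_space itself \<Rightarrow> bool" where
  "hyperbolic_space _ \<longleftrightarrow>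
     (\<exists>\<delta>. \<forall>x0 x y z::'a. gromov_product x0 x y \<ge>
        min (gromov_product x0 x z) (gromov_product x0 z y) - \<delta>)"

definition converges_to_infinity :: "'a::metric_space \<Rightarrow> (nat \<Rightarrow> 'a) \<Rightarrow> bool" where
  "converges_to_infinity x0 x \<longleftrightarrow>
     filterlim (\<lambda>(i, j). gromov_product x0 (x i) (x j)) at_top (sequentially \<times>\<^sub>F sequentially)"

definition gromov_boundary :: "'a::metric_space \<Rightarrow> (nat \<Rightarrow> 'a) set set" where
  "gromov_boundary x0 =
     {x. converges_to_infinity x0 x} //
       {(x, y). converges_to_infinity x0 x \<and> converges_to_infinity x0 y \<and>
          filterlim (\<lambda>i. gromov_product x0 (x i) (y i)) at_top sequentially}"

definition boundary_product ::
    "'a::metric_space \<Rightarrow> (nat \<Rightarrow> 'a) set \<Rightarrow> (nat \<Rightarrow> 'a) set \<Rightarrow> ereal" where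
  "boundary_product x0 \<xi> \<eta> =
     (INF x\<in>\<xi>. INF y\<in>\<eta>. liminf (\<lambda>i. ereal (gromov_product x0 (x i) (y i))))"

definition visual_topology :: "'a::metric_space \<Rightarrow> (nat \<Rightarrow> 'a) set topology" where
  "visual_topology x0 =
     topology (\<lambda>U. U \<subseteq> gromov_boundary x0 \<and>
       (\<forall>\<xi>\<in>U. \<exists>R\<ge>0. {\<eta> \<in> gromov_boundary x0. boundary_product x0 \<xi> \<eta> > ereal R} \<subseteq> U))"

lemma openin_visual_topology:
  "openin (visual_topology x0) U \<longleftrightarrow> U \<subseteq> gromov_boundary x0 \<and>
     (\<forall>\<xi>\<in>U. \<exists>R\<ge>0. {\<eta> \<in> gromov_boundary x0. boundary_product x0 \<xi> \<eta> > ereal R} \<subseteq> U)"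
proof -
  define N where "N \<xi> R = {\<eta> \<in> gromov_boundary x0. boundary_product x0 \<xi> \<eta> > ereal R}" for \<xi> R
  define P where "P U \<longleftrightarrow> U \<subseteq> gromov_boundary x0 \<and> (\<forall>\<xi>\<in>U. \<exists>R\<ge>0. N \<xi> R \<subseteq> U)" for U
  have mono: "N \<xi> R' \<subseteq> N \<xi> R" if "R \<le> R'" for \<xi> R R'
  proof
    fix \<eta> assume "\<eta> \<in> N \<xi> R'"
    moreover have "ereal R \<le> ereal R'" using that by simp
    ultimately show "\<eta> \<in> N \<xi> R" unfolding N_def using le_less_trans by blast
  qed
  have Int: "P (S \<inter> T)" if S: "P S" and T: "P T" for S T
  proof -
    have "\<exists>R\<ge>0. N \<xi> R \<subseteq> S \<inter> T" if "\<xi> \<in> S" "\<xi> \<in> T" for \<xi>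
    proof -
      obtain R where R: "R \<ge> 0" "N \<xi> R \<subseteq> S" using S \<open>\<xi> \<in> S\<close> by (auto simp: P_def)
      obtain R' where R': "R' \<ge> 0" "N \<xi> R' \<subseteq> T" using T \<open>\<xi> \<in> T\<close> by (auto simp: P_def)
      have "N \<xi> (max R R') \<subseteq> N \<xi> R" "N \<xi> (max R R') \<subseteq> N \<xi> R'"
        by (rule mono, simp)+
      then have "N \<xi> (max R R') \<subseteq> S \<inter> T" using R R' by blast
      moreover have "max R R' \<ge> 0" using R by simp
      ultimately show ?thesis by blast
    qed
    then show ?thesis using S unfolding P_def by blast
  qed
  have Un: "P (\<Union>\<K>)" if \<K>: "\<And>S. S \<in> \<K> \<Longrightarrow> P S" for \<K>
  proof -
    have "\<exists>R\<ge>0. N \<xi> R \<subseteq> \<Union>\<K>" if S: "S \<in> \<K>" and \<xi>: "\<xi> \<in> S" for S \<xi>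
    proof -
      obtain R where "R \<ge> 0" "N \<xi> R \<subseteq> S" using \<K>[OF S] \<xi> by (auto simp: P_def)
      then show ?thesis using S by blast
    qed
    moreover have "\<Union>\<K> \<subseteq> gromov_boundary x0"
      using \<K> by (auto simp: P_def)
    ultimately show ?thesis unfolding P_def by blast
  qed
  have "istopology P"
    unfolding istopology_def using Int Un by metis
  then have "openin (topology P) = P"
    by (rule topology_inverse')
  moreover have "visual_topology x0 = topology P"
    by (simp add: visual_topology_def P_def[abs_def] N_def)
  ultimately show ?thesis
    by (simp add: P_def N_def)
qed

lemma topspace_visual_topology: "topspace (visual_topology x0) = gromov_boundary x0"
proof
  show "topspace (visual_topology x0) \<subseteq> gromov_boundary x0"
    using openin_topspace[of "visual_topology x0"] unfolding openin_visual_topology by blast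
  have "openin (visual_topology x0) (gromov_boundary x0)"
    unfolding openin_visual_topology using order_refl[of "0::real"] by blast
  then show "gromov_boundary x0 \<subseteq> topspace (visual_topology x0)"
    by (rule openin_subset)
qed

definition defines_point ::
    "'a::metric_space \<Rightarrow> real \<Rightarrow> (real \<Rightarrow> 'a) \<Rightarrow> (nat \<Rightarrow> 'a) set \<Rightarrow> bool" where
  "defines_point x0 a \<gamma> \<xi> \<longleftrightarrow> \<xi> \<in> gromov_boundary x0 \<and>
     (\<forall>t::nat \<Rightarrow> real. incseq t \<and> (\<forall>i. a \<le> t i) \<and> filterlim t at_top sequentially \<longrightarrow>
        (\<lambda>i. \<gamma> (t i)) \<in> \<xi>)"


section \<open>Quasi-rulings\<close>

definition quasi_ruler :: "real \<Rightarrow> real set \<Rightarrow> (real \<Rightarrow> 'a::metric_space) \<Rightarrow> bool" where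
  "quasi_ruler D I \<gamma> \<longleftrightarrow> is_interval I \<and> closed I \<and>
     (\<forall>t\<in>I. \<forall>s\<in>I. \<forall>r\<in>I. t < s \<and> s < r \<longrightarrow>
        dist (\<gamma> t) (\<gamma> s) + dist (\<gamma> s) (\<gamma> r) \<le> dist (\<gamma> t) (\<gamma> r) + D) \<and>
     (\<forall>t0\<in>I. Limsup (at t0 within I) (\<lambda>t. ereal (dist (\<gamma> t) (\<gamma> t0))) < ereal D)"

definition admits_quasi_ruling :: "real \<Rightarrow> 'a::metric_space itself \<Rightarrow> bool" where
  "admits_quasi_ruling D _ \<longleftrightarrow>
     (\<forall>x y::'a. \<exists>a b \<gamma>. a \<le> b \<and> quasi_ruler D {a..b} \<gamma> \<and> \<gamma> a = x \<and> \<gamma> b = y)"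


section \<open>Hyperbolic projections and \<open>\<kappa>\<close>-injectivity\<close>

text \<open>The spaces \<open>Y\<close> and \<open>X\<close> are the types \<open>'y\<close> and \<open>'x\<close>, with actions \<open>\<phi>\<close> and \<open>\<psi>\<close>.\<close>

definition hyperbolic_projection ::
    "('g, 'm) monoid_scheme \<Rightarrow> ('g \<Rightarrow> 'y::metric_space \<Rightarrow> 'y) \<Rightarrow>
     ('g \<Rightarrow> 'x::metric_space \<Rightarrow> 'x) \<Rightarrow> bool" where
  "hyperbolic_projection G \<phi> \<psi> \<longleftrightarrow>
     group G \<and> finitely_generated G \<and>
     geodesic_space TYPE('y) \<and> geometric_action G \<phi> \<and>
     hyperbolic_space TYPE('x) \<and> (\<exists>D. admits_quasi_ruling D TYPE('x)) \<and>
     isometric_action G \<psi> \<and> cobounded G \<psi>"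

definition induced_projection ::
    "('g, 'm) monoid_scheme \<Rightarrow> ('g \<Rightarrow> 'y::metric_space \<Rightarrow> 'y) \<Rightarrow>
     ('g \<Rightarrow> 'x::metric_space \<Rightarrow> 'x) \<Rightarrow> ('y \<Rightarrow> 'x) \<Rightarrow> bool" where
  "induced_projection G \<phi> \<psi> p \<longleftrightarrow> coarsely_equivariant G \<phi> \<psi> p \<and> coarsely_Lipschitz p"

definition kappa_injective ::
    "(real \<Rightarrow> real) \<Rightarrow> 'y::metric_space \<Rightarrow> 'x::metric_space \<Rightarrow> ('y \<Rightarrow> 'x) \<Rightarrow> bool" where
  "kappa_injective \<kappa> y0 x0 p \<longleftrightarrow>
     (\<forall>\<gamma>\<in>kappa_rays \<kappa> y0. \<exists>\<xi>. defines_point x0 0 (p \<circ> \<gamma>) \<xi>) \<and>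
     (\<forall>\<gamma>\<in>kappa_rays \<kappa> y0. \<forall>\<gamma>'\<in>kappa_rays \<kappa> y0.
        kappa_close \<kappa> y0 \<gamma> \<gamma>' \<longleftrightarrow>
        (\<exists>\<xi>. defines_point x0 0 (p \<circ> \<gamma>) \<xi> \<and> defines_point x0 0 (p \<circ> \<gamma>') \<xi>))"

text \<open>The map \<open>[\<gamma>] \<mapsto> [p \<circ> \<gamma>]\<close> from the \<open>\<kappa>\<close>-boundary to the Gromov boundary.\<close>

definition boundary_projection ::
    "'x::metric_space \<Rightarrow> ('y::metric_space \<Rightarrow> 'x) \<Rightarrow> (real \<Rightarrow> 'y) set \<Rightarrow> (nat \<Rightarrow> 'x) set" where
  "boundary_projection x0 p c = (THE \<xi>. \<forall>\<gamma>\<in>c. defines_point x0 0 (p \<circ> \<gamma>) \<xi>)"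

definition projection_topology ::
    "(real \<Rightarrow> real) \<Rightarrow> 'y::metric_space \<Rightarrow> 'x::metric_space \<Rightarrow> ('y \<Rightarrow> 'x) \<Rightarrow>
     (real \<Rightarrow> 'y) set topology" where
  "projection_topology \<kappa> y0 x0 p =
     pullback_topology (kappa_boundary \<kappa> y0) (boundary_projection x0 p) (visual_topology x0)"

end

theory Submission
  imports Defs
begin

text \<open>
  The two maps \<open>p' \<circ> \<Psi>\<close> and \<open>f \<circ> p\<close>, where \<open>f\<close> is the quasi-isometry between the hyperbolic spaces, are
  at bounded distance, because both are coarsely equivariant and coarsely Lipschitz and the action on
  \<open>Y\<close> is cobounded. A quasi-isometry between hyperbolic spaces admitting quasi-rulings changes Gromov
  products only by affine bounds, so it induces a homeomorphism \<open>\<partial>f\<close> of the Gromov boundaries and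
  \<open>p\<close> and \<open>p' \<circ> \<Psi>\<close> detect convergence to infinity and equality of limits in the same way. As \<open>\<Psi>\<close> and
  its coarse inverse preserve Morse rays and closeness, injectivity is transferred, and
  \<open>\<partial>p' \<circ> \<partial>\<Psi> = \<partial>f \<circ> \<partial>p\<close> shows that \<open>\<partial>\<Psi>\<close> is a homeomorphism of the pulled back topologies.

  The transfer along \<open>\<Psi>\<close> needs \<open>\<kappa> 0 > 0\<close>. If \<open>\<kappa>\<close> vanishes identically, then Morse rays would be dense and do
  not exist; if only \<open>\<kappa> 0 = 0\<close>, then \<open>\<kappa>\<close> can be replaced by \<open>\<kappa> + 1\<close> after moving the initial point of a
  ray to the base point.
\<close>

section \<open>Quasi-isometries\<close>

text \<open>The hyperbolic spaces need not be geodesic, so there are no geodesics on which a bound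
  for Gromov products could rest. Coarse paths take their place: a quasi-ruler from \<open>x\<close>
  to \<open>y\<close> recedes from \<open>w\<close> at a linear rate on both sides of one parameter,
  a quasi-isometry keeps such a rate, and in a hyperbolic space this already bounds the product of
  the end points from below. The opposite bound is the same statement for a coarse inverse.

  The base point is what separates the cases of \<open>\<kappa>\<close>. If
  \<open>\<kappa> 0 = 0\<close>, a Morse ray must have \<open>y0\<close> in the closure of its
  image, so \<open>\<Psi> \<circ> \<gamma>\<close> can fail to be Morse with respect to an unrelated
  base point \<open>y0'\<close>; this is why the homeomorphism is claimed for
  \<open>0 < \<kappa> 0\<close>. Injectivity does not depend on where a ray starts, since limit
  points and closeness for \<open>\<kappa> + 1\<close> survive a change at one time. Hence the
  equivalence holds for every sublinear \<open>\<kappa>\<close>.\<close>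

lemma qi_embedding_onD:
  assumes "qi_embedding_on K C S f"
  shows "1 \<le> K" "0 \<le> C"
    and "x \<in> S \<Longrightarrow> y \<in> S \<Longrightarrow> dist (f x) (f y) \<le> K * dist x y + C"
    and "x \<in> S \<Longrightarrow> y \<in> S \<Longrightarrow> dist x y / K - C \<le> dist (f x) (f y)"
    and "x \<in> S \<Longrightarrow> y \<in> S \<Longrightarrow> dist x y \<le> K * (dist (f x) (f y) + C)"
proof -
  show *: "1 \<le> K" "0 \<le> C"
    and "x \<in> S \<Longrightarrow> y \<in> S \<Longrightarrow> dist (f x) (f y) \<le> K * dist x y + C"
    and "x \<in> S \<Longrightarrow> y \<in> S \<Longrightarrow> dist x y / K - C \<le> dist (f x) (f y)"
    using assms by (auto simp: qi_embedding_on_def)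
  show "dist x y \<le> K * (dist (f x) (f y) + C)" if "x \<in> S" "y \<in> S"
  proof -
    have "dist x y / K \<le> dist (f x) (f y) + C"
      using assms that by (fastforce simp: qi_embedding_on_def)
    then show ?thesis using * by (simp add: divide_le_eq mult.commute)
  qed
qed

lemma qi_embedding_on_comp:
  assumes f: "qi_embedding_on K1 C1 S f" and g: "qi_embedding_on K2 C2 UNIV g"
  shows "qi_embedding_on (K1 * K2) (K2 * C1 + C2) S (g \<circ> f)"
proof -
  have K: "1 \<le> K1" "0 \<le> C1" "1 \<le> K2" "0 \<le> C2"
    using qi_embedding_onD(1,2)[OF f] qi_embedding_onD(1,2)[OF g] by auto
  have "dist (g (f x)) (g (f y)) \<le> K1 * K2 * dist x y + (K2 * C1 + C2) \<and>
      dist x y / (K1 * K2) - (K2 * C1 + C2) \<le> dist (g (f x)) (g (f y))"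
    if "x \<in> S" "y \<in> S" for x y
  proof
    have "dist (g (f x)) (g (f y)) \<le> K2 * dist (f x) (f y) + C2"
      by (rule qi_embedding_onD(3)[OF g]) auto
    also have "\<dots> \<le> K2 * (K1 * dist x y + C1) + C2"
      using qi_embedding_onD(3)[OF f that] K by simp
    finally show "dist (g (f x)) (g (f y)) \<le> K1 * K2 * dist x y + (K2 * C1 + C2)"
      by (simp add: algebra_simps)
    have "dist x y / (K1 * K2) - C1 / K2 = (dist x y / K1 - C1) / K2"
      by (simp add: diff_divide_distrib)
    also have "\<dots> \<le> dist (f x) (f y) / K2"
      using qi_embedding_onD(4)[OF f that] K by (intro divide_right_mono) auto
    also have "\<dots> \<le> dist (g (f x)) (g (f y)) + C2"
      using qi_embedding_onD(4)[OF g, of "f x" "f y"] by auto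
    finally have "dist x y / (K1 * K2) - C1 / K2 \<le> dist (g (f x)) (g (f y)) + C2" .
    moreover have "C1 / K2 \<le> K2 * C1"
    proof -
      have "C1 / K2 \<le> C1" using K by (simp add: divide_le_eq mult_left_le mult_le_cancel_left1)
      also have "\<dots> \<le> K2 * C1" using K by (simp add: mult_le_cancel_right1)
      finally show ?thesis .
    qed
    ultimately show "dist x y / (K1 * K2) - (K2 * C1 + C2) \<le> dist (g (f x)) (g (f y))"
      by linarith
  qed
  moreover have "1 \<le> K1 * K2" using mult_mono[of 1 K1 1 K2] K by simp
  moreover have "0 \<le> K2 * C1 + C2" using K by simp
  ultimately show ?thesis by (auto simp: qi_embedding_on_def)
qed

lemma qi_embedding_on_perturb:
  assumes f: "qi_embedding_on K C S f" and M: "\<And>x. x \<in> S \<Longrightarrow> dist (f x) (g x) \<le> M" and "0 \<le> M"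
  shows "qi_embedding_on K (C + 2 * M) S g"
proof -
  have "dist (g x) (g y) \<le> K * dist x y + (C + 2 * M) \<and>
      dist x y / K - (C + 2 * M) \<le> dist (g x) (g y)" if "x \<in> S" "y \<in> S" for x y
  proof -
    have "dist (g x) (g y) \<le> dist (f x) (f y) + 2 * M" "dist (f x) (f y) \<le> dist (g x) (g y) + 2 * M"
      using M[OF that(1)] M[OF that(2)] by metric+
    then show ?thesis
      using qi_embedding_onD(3,4)[OF f that] by linarith
  qed
  moreover have "1 \<le> K" "0 \<le> C + 2 * M" using qi_embedding_onD(1,2)[OF f] \<open>0 \<le> M\<close> by auto
  ultimately show ?thesis by (auto simp: qi_embedding_on_def)
qed

text \<open>Distances between values of \<open>g\<close> are compared through \<open>f\<close>,
  whose values at \<open>g x\<close> and \<open>g y\<close> lie within \<open>R\<close> of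
  \<open>x\<close> and \<open>y\<close>. The section is arbitrary, because one adapted to a given
  Morse set is used in \<open>kappa_Morse_quasi_isometry\<close>.\<close>

lemma coarse_section:
  assumes f: "qi_embedding_on K C UNIV f" and R: "\<And>y. dist (f (g y)) y \<le> R"
  shows "qi_embedding_on K (K * (2 * R + C)) UNIV g" and "dist (g (f x)) x \<le> K * (R + C)"
proof -
  have K: "1 \<le> K" "0 \<le> C" using qi_embedding_onD(1,2)[OF f] by auto
  have R0: "0 \<le> R" using R[of undefined] zero_le_dist order_trans by blast
  show "dist (g (f x)) x \<le> K * (R + C)"
  proof -
    have "dist (g (f x)) x \<le> K * (dist (f (g (f x))) (f x) + C)"
      by (rule qi_embedding_onD(5)[OF f]) auto
    also have "\<dots> \<le> K * (R + C)" using R[of "f x"] K by (intro mult_left_mono) auto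
    finally show ?thesis .
  qed
  have "dist (g x) (g y) \<le> K * dist x y + K * (2 * R + C) \<and>
      dist x y / K - K * (2 * R + C) \<le> dist (g x) (g y)" for x y
  proof
    have d: "dist (f (g x)) (f (g y)) \<le> dist x y + 2 * R" "dist x y \<le> dist (f (g x)) (f (g y)) + 2 * R"
      using R[of x] R[of y] by metric+
    have "dist (g x) (g y) \<le> K * (dist (f (g x)) (f (g y)) + C)"
      by (rule qi_embedding_onD(5)[OF f]) auto
    also have "\<dots> \<le> K * (dist x y + 2 * R + C)" using d K by (intro mult_left_mono) auto
    finally show "dist (g x) (g y) \<le> K * dist x y + K * (2 * R + C)" by (simp add: algebra_simps)
    have "dist x y \<le> K * dist (g x) (g y) + C + 2 * R"
      using d qi_embedding_onD(3)[OF f, of "g x" "g y"] by simp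
    then have "dist x y / K \<le> (K * dist (g x) (g y) + (C + 2 * R)) / K"
      using K by (intro divide_right_mono) auto
    also have "\<dots> = dist (g x) (g y) + (C + 2 * R) / K"
      using K by (simp add: add_divide_distrib)
    also have "(C + 2 * R) / K \<le> C + 2 * R"
      using K R0 by (simp add: divide_le_eq mult_le_cancel_left1)
    also have "C + 2 * R \<le> K * (2 * R + C)"
      using K R0 mult_right_mono[of 1 K "C + 2 * R"] by (simp add: add.commute)
    finally show "dist x y / K - K * (2 * R + C) \<le> dist (g x) (g y)" by simp
  qed
  moreover have "0 \<le> K * (2 * R + C)" using K R0 by simp
  ultimately show "qi_embedding_on K (K * (2 * R + C)) UNIV g"
    using K by (auto simp: qi_embedding_on_def)
qed

lemma quasi_isometry_section:
  assumes "quasi_isometry f"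
  obtains g R where "\<And>y. dist (f (g y)) y \<le> R"
proof -
  obtain R where "\<forall>y. \<exists>a\<in>range f. dist y a \<le> R"
    using assms unfolding quasi_isometry_def coarsely_dense_def by blast
  then have "\<forall>y. \<exists>x. dist (f x) y \<le> R" by (metis dist_commute imageE)
  then show ?thesis using that by metis
qed

lemma quasi_isometry_inverse:
  assumes "quasi_isometry f"
  obtains g M where "quasi_isometry g"
    and "\<And>x. dist (g (f x)) x \<le> M" and "\<And>y. dist (f (g y)) y \<le> M"
proof -
  obtain K C where f: "qi_embedding_on K C UNIV f"
    using assms by (auto simp: quasi_isometry_def)
  obtain g R where R: "\<And>y. dist (f (g y)) y \<le> R"
    using quasi_isometry_section[OF assms] by blast
  note g = coarse_section[OF f R]
  have "\<forall>x. \<exists>a\<in>range g. dist x a \<le> K * (R + C)"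
    using g(2) by (metis dist_commute rangeI)
  then have "quasi_isometry g"
    using g(1) unfolding quasi_isometry_def coarsely_dense_def by blast
  moreover have "dist (g (f x)) x \<le> max R (K * (R + C))" for x using g(2)[of x] by linarith
  moreover have "dist (f (g y)) y \<le> max R (K * (R + C))" for y using R[of y] by linarith
  ultimately show ?thesis using that by blast
qed

lemma quasi_isometry_imp_coarsely_Lipschitz: "quasi_isometry f \<Longrightarrow> coarsely_Lipschitz f"
  unfolding quasi_isometry_def qi_embedding_on_def coarsely_Lipschitz_def by fast

lemma coarsely_Lipschitz_bound:
  assumes "coarsely_Lipschitz f"
  obtains B where "\<And>x y. dist x y \<le> M \<Longrightarrow> dist (f x) (f y) \<le> B"
proof -
  obtain K C where KC: "K \<ge> 1" "\<And>x y. dist (f x) (f y) \<le> K * dist x y + C"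
    using assms unfolding coarsely_Lipschitz_def by blast
  have "dist (f x) (f y) \<le> K * M + C" if "dist x y \<le> M" for x y
    using KC(2)[of x y] mult_left_mono[OF that, of K] KC(1) by linarith
  then show ?thesis using that by blast
qed

lemma coarsely_Lipschitz_comp:
  assumes f: "coarsely_Lipschitz f" and g: "coarsely_Lipschitz g"
  shows "coarsely_Lipschitz (g \<circ> f)"
proof -
  obtain K C where KC: "K \<ge> 1" "C \<ge> 0" "\<And>x y. dist (f x) (f y) \<le> K * dist x y + C"
    using f unfolding coarsely_Lipschitz_def by blast
  obtain K' C' where KC': "K' \<ge> 1" "C' \<ge> 0" "\<And>x y. dist (g x) (g y) \<le> K' * dist x y + C'"
    using g unfolding coarsely_Lipschitz_def by blast
  have "dist (g (f x)) (g (f y)) \<le> (K' * K) * dist x y + (K' * C + C')" for x y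
  proof -
    have "dist (g (f x)) (g (f y)) \<le> K' * dist (f x) (f y) + C'" by (rule KC')
    also have "\<dots> \<le> K' * (K * dist x y + C) + C'" using KC KC' by simp
    finally show ?thesis by (simp add: algebra_simps)
  qed
  moreover have "1 \<le> K' * K" using mult_mono[of 1 K' 1 K] KC KC' by simp
  moreover have "0 \<le> K' * C + C'" using KC KC' by simp
  ultimately show ?thesis unfolding coarsely_Lipschitz_def comp_def by blast
qed


section \<open>Coarsely equivariant maps\<close>

lemma coarsely_equivariant_comp:
  assumes f: "coarsely_equivariant G \<phi> \<psi> f" and g: "coarsely_equivariant G \<psi> \<theta> g"
    and "coarsely_Lipschitz g"
  shows "coarsely_equivariant G \<phi> \<theta> (g \<circ> f)"
proof -
  obtain C where C: "\<And>h x. h \<in> carrier G \<Longrightarrow> dist (f (\<phi> h x)) (\<psi> h (f x)) \<le> C"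
    using f unfolding coarsely_equivariant_def by blast
  obtain C' where C': "\<And>h x. h \<in> carrier G \<Longrightarrow> dist (g (\<psi> h x)) (\<theta> h (g x)) \<le> C'"
    using g unfolding coarsely_equivariant_def by blast
  obtain B where B: "\<And>x y. dist x y \<le> C \<Longrightarrow> dist (g x) (g y) \<le> B"
    using coarsely_Lipschitz_bound[OF assms(3)] by blast
  have "dist (g (f (\<phi> h x))) (\<theta> h (g (f x))) \<le> B + C'" if "h \<in> carrier G" for h x
    using B[OF C[OF that, of x]] C'[OF that, of "f x"] by metric
  then show ?thesis unfolding coarsely_equivariant_def comp_def by blast
qed

lemma cocompact_imp_cobounded: "cocompact G \<phi> \<Longrightarrow> cobounded G \<phi>"
  unfolding cocompact_def cobounded_def using compact_imp_bounded by blast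

lemma coboundedE:
  assumes "cobounded G \<phi>"
  obtains B e where "\<And>x y. x \<in> B \<Longrightarrow> y \<in> B \<Longrightarrow> dist x y \<le> e"
    and "\<And>x. \<exists>g\<in>carrier G. \<exists>b\<in>B. x = \<phi> g b"
proof -
  obtain B where B: "bounded B" "(\<Union>g\<in>carrier G. \<phi> g ` B) = UNIV"
    using assms unfolding cobounded_def by blast
  obtain e where "\<forall>x\<in>B. \<forall>y\<in>B. dist x y \<le> e"
    using B(1) unfolding bounded_two_points by blast
  moreover have "\<exists>g\<in>carrier G. \<exists>b\<in>B. x = \<phi> g b" for x
  proof -
    have "x \<in> (\<Union>g\<in>carrier G. \<phi> g ` B)" unfolding B(2) by simp
    then show ?thesis by blast
  qed
  ultimately show ?thesis using that by blast
qed

text \<open>Every point is a translate of a point of a bounded set \<open>B\<close>. On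
  \<open>B\<close> both maps stay near their values at \<open>b\<close>, and translating costs only
  the two equivariance errors, because \<open>\<psi>\<close> acts by isometries.\<close>

lemma coarsely_equivariant_bounded_distance:
  assumes "cobounded G \<phi>" and \<psi>: "isometric_action G \<psi>"
    and p: "coarsely_equivariant G \<phi> \<psi> p" "coarsely_Lipschitz p"
    and q: "coarsely_equivariant G \<phi> \<psi> q" "coarsely_Lipschitz q"
  obtains M where "\<And>y. dist (p y) (q y) \<le> M"
proof -
  obtain B e where e: "\<And>x y. x \<in> B \<Longrightarrow> y \<in> B \<Longrightarrow> dist x y \<le> e"
    and cover: "\<And>x. \<exists>g\<in>carrier G. \<exists>b\<in>B. x = \<phi> g b"
    by (rule coboundedE[OF assms(1)]) blast
  obtain b where b: "b \<in> B" using cover by blast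
  obtain M1 where M1: "\<And>x y. dist x y \<le> e \<Longrightarrow> dist (p x) (p y) \<le> M1"
    using coarsely_Lipschitz_bound[OF p(2)] by blast
  obtain M2 where M2: "\<And>x y. dist x y \<le> e \<Longrightarrow> dist (q x) (q y) \<le> M2"
    using coarsely_Lipschitz_bound[OF q(2)] by blast
  obtain C1 where C1: "\<And>h x. h \<in> carrier G \<Longrightarrow> dist (p (\<phi> h x)) (\<psi> h (p x)) \<le> C1"
    using p(1) unfolding coarsely_equivariant_def by blast
  obtain C2 where C2: "\<And>h x. h \<in> carrier G \<Longrightarrow> dist (q (\<phi> h x)) (\<psi> h (q x)) \<le> C2"
    using q(1) unfolding coarsely_equivariant_def by blast
  have "dist (p y) (q y) \<le> C1 + (M1 + dist (p b) (q b) + M2) + C2" for y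
  proof -
    obtain g z where g: "g \<in> carrier G" "z \<in> B" "y = \<phi> g z"
      using cover by blast
    have "dist (\<psi> g (p z)) (\<psi> g (q z)) = dist (p z) (q z)"
      using \<psi> g unfolding isometric_action_def by blast
    also have "\<dots> \<le> M1 + dist (p b) (q b) + M2"
      using M1[OF e[OF g(2) b]] M2[OF e[OF g(2) b]] by metric
    finally show ?thesis using C1[OF g(1), of z] C2[OF g(1), of z] g(3) by metric
  qed
  then show ?thesis using that by blast
qed

text \<open>Coarse homogeneity, used to exclude coarsely dense rays. The isometry carries
  \<open>x\<close> back into the bounded set \<open>B\<close> and then out to the translate of
  \<open>B\<close> that contains \<open>y\<close>.\<close>

lemma cobounded_transitive:
  fixes \<phi> :: "'g \<Rightarrow> 'a::metric_space \<Rightarrow> 'a"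
  assumes "cobounded G \<phi>" "isometric_action G \<phi>"
  obtains M where
    "\<And>x y::'a. \<exists>h::'a \<Rightarrow> 'a. (\<forall>u v. dist (h u) (h v) = dist u v) \<and> dist (h x) y \<le> M"
proof -
  interpret group_action G UNIV \<phi> using assms(2) by (simp add: isometric_action_def)
  have grp: "group G" using group_hom by (simp add: group_hom_def)
  obtain B e where e: "\<And>x y. x \<in> B \<Longrightarrow> y \<in> B \<Longrightarrow> dist x y \<le> e"
    and cover: "\<And>x. \<exists>g\<in>carrier G. \<exists>b\<in>B. x = \<phi> g b"
    by (rule coboundedE[OF assms(1)]) blast
  have iso: "dist (\<phi> g u) (\<phi> g v) = dist u v" if "g \<in> carrier G" for g u v
    using assms(2) that unfolding isometric_action_def by blast
  have "\<exists>h::'a \<Rightarrow> 'a. (\<forall>u v. dist (h u) (h v) = dist u v) \<and> dist (h x) y \<le> e" for x y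
  proof -
    obtain g b where g: "g \<in> carrier G" "b \<in> B" "x = \<phi> g b"
      using cover by blast
    obtain g' b' where g': "g' \<in> carrier G" "b' \<in> B" "y = \<phi> g' b'"
      using cover by blast
    have inv: "inv\<^bsub>G\<^esub> g \<in> carrier G" using group.inv_closed[OF grp g(1)] .
    have "\<phi> (inv\<^bsub>G\<^esub> g) x = b" using orbit_sym_aux[OF g(1)] g(3) by blast
    then have "dist (\<phi> g' (\<phi> (inv\<^bsub>G\<^esub> g) x)) y \<le> e"
      using e[OF g(2) g'(2)] iso[OF g'(1)] g'(3) by simp
    then show ?thesis using iso[OF g'(1)] iso[OF inv] by (intro exI[of _ "\<lambda>u. \<phi> g' (\<phi> (inv\<^bsub>G\<^esub> g) u)"]) simp
  qed
  then show ?thesis using that by blast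
qed

section \<open>Gromov products and quasi-isometries\<close>

lemma gromov_product_commute: "gromov_product w x y = gromov_product w y x"
  by (simp add: gromov_product_def dist_commute)

lemma gromov_product_ge: "dist w x - dist x y \<le> gromov_product w x y"
  unfolding gromov_product_def using dist_triangle[of w x y] dist_commute[of x y] by argo

lemma gromov_product_perturb:
  "gromov_product w x y \<le> gromov_product w' x' y' + (dist w w' + dist x x' + dist y y')"
proof -
  have "dist w x \<le> dist w' x' + dist w w' + dist x x'" by metric
  moreover have "dist w y \<le> dist w' y' + dist w w' + dist y y'" by metric
  moreover have "dist x' y' \<le> dist x y + dist x x' + dist y y'" by metric
  ultimately show ?thesis unfolding gromov_product_def by argo
qed

text \<open>The quasi-ruler is reparametrised by the distance to its initial point; this loses nothing
  coarsely because condition (2) bounds its jumps.\<close>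

lemma quasi_ruling_path:
  assumes "admits_quasi_ruling D TYPE('a::metric_space)"
  obtains E where "0 \<le> E" and
    "\<And>x y::'a. \<exists>c. \<forall>s\<in>{0..dist x y}. \<bar>dist x (c s) - s\<bar> \<le> E \<and>
       dist x (c s) + dist (c s) y \<le> dist x y + E \<and>
       (\<forall>s'\<in>{0..dist x y}. dist (c s) (c s') \<le> \<bar>s - s'\<bar> + 3 * E)"
proof -
  \<comment> \<open>The maximum covers the one-point space, where nothing forces \<open>D\<close> to
    be non-negative.\<close>
  define E where "E = max D 0"
  have E: "0 \<le> E" "D \<le> E" by (auto simp: E_def)
  have "\<exists>c. \<forall>s\<in>{0..dist x y}. \<bar>dist x (c s) - s\<bar> \<le> E \<and>
       dist x (c s) + dist (c s) y \<le> dist x y + E \<and>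
       (\<forall>s'\<in>{0..dist x y}. dist (c s) (c s') \<le> \<bar>s - s'\<bar> + 3 * E)" for x y :: 'a
  proof -
    obtain a b \<gamma> where ab: "a \<le> b" and q: "quasi_ruler D {a..b} \<gamma>" and xy: "\<gamma> a = x" "\<gamma> b = y"
      using assms unfolding admits_quasi_ruling_def by blast
    have rule: "dist (\<gamma> t) (\<gamma> s) + dist (\<gamma> s) (\<gamma> r) \<le> dist (\<gamma> t) (\<gamma> r) + E"
      if "t \<in> {a..b}" "s \<in> {a..b}" "r \<in> {a..b}" "t \<le> s" "s \<le> r" for t s r
    proof (cases "t = s \<or> s = r")
      case True
      then show ?thesis using E by auto
    next
      case False
      then have "dist (\<gamma> t) (\<gamma> s) + dist (\<gamma> s) (\<gamma> r) \<le> dist (\<gamma> t) (\<gamma> r) + D"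
        using q that unfolding quasi_ruler_def by (meson order_le_less)
      then show ?thesis using E by linarith
    qed
    have "\<exists>t\<in>{a..b}. \<bar>dist x (\<gamma> t) - s\<bar> \<le> E" if s: "s \<in> {0..dist x y}" for s
    proof -
      \<comment> \<open>\<open>Sup T\<close> is, up to a jump, the last moment at which the path is
        within \<open>s\<close> of \<open>x\<close>. Arbitrarily near it there are points of
        \<open>T\<close> and, unless it is \<open>b\<close>, later points outside \<open>T\<close>;
        by \<open>near'\<close> their values are \<open>E\<close>-close to the value at
        \<open>Sup T\<close>.\<close>
      define T where "T = {t\<in>{a..b}. dist x (\<gamma> t) \<le> s}"
      have aT: "a \<in> T" using ab xy s by (auto simp: T_def)
      have bdd: "bdd_above T" by (auto simp: T_def bdd_above_def)
      define t0 where "t0 = Sup T"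
      have "a \<le> t0" unfolding t0_def by (rule cSup_upper[OF aT bdd])
      moreover have "t0 \<le> b" unfolding t0_def by (rule cSup_least) (use aT in \<open>auto simp: T_def\<close>)
      ultimately have t0: "t0 \<in> {a..b}" by simp
      have "Limsup (at t0 within {a..b}) (\<lambda>t. ereal (dist (\<gamma> t) (\<gamma> t0))) < ereal D"
        using q t0 unfolding quasi_ruler_def by blast
      then have "\<forall>\<^sub>F t in at t0 within {a..b}. ereal (dist (\<gamma> t) (\<gamma> t0)) < ereal D"
        by (rule Limsup_lessD)
      then obtain e where e: "e > 0"
        and near: "\<And>t. t \<in> {a..b} \<Longrightarrow> t \<noteq> t0 \<Longrightarrow> dist t t0 < e \<Longrightarrow> dist (\<gamma> t) (\<gamma> t0) < D"
        unfolding eventually_at by auto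
      have near': "dist (\<gamma> t) (\<gamma> t0) \<le> E" if "t \<in> {a..b}" "\<bar>t - t0\<bar> < e" for t
        using near[OF that(1)] that(2) E by (cases "t = t0") (auto simp: dist_real_def)
      obtain t where t: "t \<in> T" "t0 - e < t"
        using less_cSup_iff[of T "t0 - e"] aT bdd e unfolding t0_def by auto
      have "t \<le> t0" unfolding t0_def by (rule cSup_upper[OF t(1) bdd])
      then have "dist (\<gamma> t) (\<gamma> t0) \<le> E" using near'[of t] t by (auto simp: T_def)
      moreover have "dist x (\<gamma> t) \<le> s" using t(1) by (simp add: T_def)
      ultimately have upper: "dist x (\<gamma> t0) \<le> s + E" by metric
      have lower: "s - E \<le> dist x (\<gamma> t0)"
      proof (cases "t0 = b")
        case True
        then show ?thesis using xy s E by simp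
      next
        case False
        define r where "r = min b (t0 + e / 2)"
        have r: "r \<in> {a..b}" "t0 < r" "\<bar>r - t0\<bar> < e" using False t0 e by (auto simp: r_def)
        have "r \<notin> T" using cSup_upper[OF _ bdd, of r] r(2) unfolding t0_def by force
        then have "s < dist x (\<gamma> r)" using r(1) by (auto simp: T_def)
        then show ?thesis using near'[OF r(1,3)] by metric
      qed
      show ?thesis using upper lower t0 by (intro bexI[of _ t0]) auto
    qed
    then obtain \<tau> where \<tau>: "\<And>s. s \<in> {0..dist x y} \<Longrightarrow> \<tau> s \<in> {a..b} \<and> \<bar>dist x (\<gamma> (\<tau> s)) - s\<bar> \<le> E"
      by metis
    \<comment> \<open>\<open>\<tau>\<close> comes from a choice and is not known to be monotone, so
      the two parameters are ordered by their \<open>\<tau>\<close>-values. One \<open>E\<close> is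
      the quasi-ruler error for \<open>a\<close>, \<open>\<tau> s\<close>, \<open>\<tau> s'\<close>;
      the other two are the errors in the distances from \<open>x\<close>.\<close>
    have ordered: "dist (\<gamma> (\<tau> s)) (\<gamma> (\<tau> s')) \<le> \<bar>s - s'\<bar> + 3 * E"
      if "s \<in> {0..dist x y}" "s' \<in> {0..dist x y}" "\<tau> s \<le> \<tau> s'" for s s'
      using rule[of a "\<tau> s" "\<tau> s'"] \<tau>[OF that(1)] \<tau>[OF that(2)] that(3) ab xy by auto
    have "dist (\<gamma> (\<tau> s)) (\<gamma> (\<tau> s')) \<le> \<bar>s - s'\<bar> + 3 * E"
      if "s \<in> {0..dist x y}" "s' \<in> {0..dist x y}" for s s'
      using ordered[OF that] ordered[OF that(2,1)] by (cases "\<tau> s \<le> \<tau> s'") (auto simp: dist_commute abs_minus_commute)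
    moreover have "dist x (\<gamma> (\<tau> s)) + dist (\<gamma> (\<tau> s)) y \<le> dist x y + E" if "s \<in> {0..dist x y}" for s
      using rule[of a "\<tau> s" b] \<tau>[OF that] ab xy by auto
    ultimately show ?thesis using \<tau> by (intro exI[of _ "\<lambda>s. \<gamma> (\<tau> s)"]) blast
  qed
  then show ?thesis using that E(1) by blast
qed

text \<open>If a coarse path moves away from \<open>w\<close> at a linear rate and is cut into steps long enough to gain
  at least \<open>\<delta>\<close> each, then the loss of \<open>\<delta>\<close> per step in the hyperbolicity inequality is compensated, so
  the Gromov product of the end points is controlled by the first step, however many steps there are.\<close>

lemma gromov_product_escaping_path:
  fixes c :: "real \<Rightarrow> 'a::metric_space"
  assumes hyp: "\<And>x y z::'a. min (gromov_product w x z) (gromov_product w z y) - \<delta> \<le> gromov_product w x y"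
    and "0 \<le> \<delta>" "0 < K" "0 \<le> B" "0 \<le> L" "\<delta> \<le> L / K"
    and "0 \<le> l" "l \<le> real n * L"
    and "\<And>s. s \<in> {0..l} \<Longrightarrow> a + s / K \<le> dist w (c s)"
    and "\<And>s s'. s \<in> {0..l} \<Longrightarrow> s' \<in> {0..l} \<Longrightarrow> dist (c s) (c s') \<le> K * \<bar>s - s'\<bar> + B"
  shows "a - (K * L + B) - \<delta> \<le> gromov_product w (c 0) (c l)"
  using assms(7-)
proof (induction n arbitrary: a c l)
  case (0 a c l)
  then have l: "l = 0" by simp
  have "a \<le> dist w (c 0)" "dist (c 0) (c 0) = 0" using "0.prems"(3)[of 0] l by auto
  moreover have "0 \<le> K * L" using assms(3,5) by simp
  ultimately show ?case using l gromov_product_ge[of w "c 0" "c 0"] assms(2,4) by simp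
next
  case (Suc n a c l)
  note esc = Suc.prems(3) and lip = Suc.prems(4)
  show ?case
  proof (cases "l \<le> L")
    case True
    have "a \<le> dist w (c 0)" using esc[of 0] Suc.prems by auto
    moreover have "dist (c 0) (c l) \<le> K * l + B" using lip[of 0 l] Suc.prems by auto
    moreover have "K * l \<le> K * L" using True assms(2-6) by simp
    ultimately show ?thesis using gromov_product_ge[of w "c 0" "c l"] assms(2-6) by linarith
  next
    case False
    have 1: "a - (K * L + B) \<le> gromov_product w (c 0) (c L)"
    proof -
      have "a \<le> dist w (c 0)" using esc[of 0] Suc.prems by auto
      moreover have "dist (c 0) (c L) \<le> K * L + B" using lip[of 0 L] Suc.prems False assms(2-6) by auto
      ultimately show ?thesis using gromov_product_ge[of w "c 0" "c L"] by linarith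
    qed
    \<comment> \<open>After a shift by \<open>L\<close> the path starts at height
      \<open>a + L / K\<close>, and \<open>\<delta> \<le> L / K\<close> absorbs the
      \<open>\<delta>\<close> lost in the induction hypothesis.\<close>
    have "(a + L / K) - (K * L + B) - \<delta> \<le> gromov_product w (c (0 + L)) (c ((l - L) + L))"
    proof (rule Suc.IH)
      show "0 \<le> l - L" using False by simp
      show "l - L \<le> real n * L" using Suc.prems by (simp add: algebra_simps)
      show "a + L / K + s / K \<le> dist w (c (s + L))" if "s \<in> {0..l - L}" for s
        using esc[of "s + L"] that assms(2-6) by (auto simp: add_divide_distrib add_ac)
      show "dist (c (s + L)) (c (s' + L)) \<le> K * \<bar>s - s'\<bar> + B"
        if "s \<in> {0..l - L}" "s' \<in> {0..l - L}" for s s'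
        using lip[of "s + L" "s' + L"] that assms(2-6) by auto
    qed
    then have "a - (K * L + B) \<le> gromov_product w (c L) (c l)" using assms(2-6) by simp
    then show ?thesis using 1 hyp[of "c 0" "c L" "c l"] by linarith
  qed
qed

text \<open>In a tree, the distance from \<open>w\<close> to the geodesic from \<open>x\<close> to
  \<open>y\<close> is \<open>gromov_product w x y\<close>, attained at a branch point, and along the
  geodesic it grows with slope 1 on both sides. The triangle inequality gives the same lower bound,
  up to a constant, along a quasi-ruler. Since \<open>f\<close> turns slope 1 into slope
  \<open>1 / K\<close>, \<open>gromov_product_escaping_path\<close> applies to each half of the
  image, and hyperbolicity joins the halves.\<close>

lemma qi_embedding_gromov_product:
  fixes f :: "'a::metric_space \<Rightarrow> 'b::metric_space"
  assumes f: "qi_embedding_on K C UNIV f"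
    and "admits_quasi_ruling D TYPE('a)" and "hyperbolic_space TYPE('b)"
  obtains A where "\<And>w x y. gromov_product w x y \<le> K * gromov_product (f w) (f x) (f y) + A"
proof -
  have K: "1 \<le> K" "0 \<le> C" using qi_embedding_onD(1,2)[OF f] by auto
  obtain \<delta>0 where \<delta>0: "\<And>w x y z::'b. min (gromov_product w x z) (gromov_product w z y) - \<delta>0 \<le> gromov_product w x y"
    using assms(3) unfolding hyperbolic_space_def by blast
  \<comment> \<open>\<open>\<delta> \<ge> 1\<close> makes the step length
    \<open>L = K * \<delta>\<close> positive, so finitely many steps cover any path; each step gains
    \<open>L / K = \<delta>\<close>.\<close>
  define \<delta> where "\<delta> = max \<delta>0 1"
  have \<delta>: "1 \<le> \<delta>" by (simp add: \<delta>_def)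
  have hyp: "min (gromov_product w x z) (gromov_product w z y) - \<delta> \<le> gromov_product w x y" for w x y z :: 'b
    using \<delta>0[of w x z y] unfolding \<delta>_def by linarith
  obtain E where E: "0 \<le> E" and path: "\<And>x y::'a. \<exists>c. \<forall>s\<in>{0..dist x y}. \<bar>dist x (c s) - s\<bar> \<le> E \<and>
       dist x (c s) + dist (c s) y \<le> dist x y + E \<and>
       (\<forall>s'\<in>{0..dist x y}. dist (c s) (c s') \<le> \<bar>s - s'\<bar> + 3 * E)"
    using quasi_ruling_path[OF assms(2)] by blast
  define L where "L = K * \<delta>"
  define B where "B = 3 * K * E + C"
  have LB: "0 < L" "0 \<le> B" "\<delta> \<le> L / K" using K E \<delta> by (auto simp: L_def B_def)
  \<comment> \<open>The terms are the loss in \<open>a\<close>, the first step of an escaping path,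
    one \<open>\<delta>\<close> for the halves and one for joining them, and the errors
    \<open>K * E + C\<close> and \<open>2 * K * E + C\<close> between the ends of the image path and
    \<open>f x\<close>, \<open>f y\<close>.\<close>
  define Q where "Q = 2 * E / K + C + (K * L + B) + 2 * \<delta> + 3 * K * E + 2 * C"
  have "gromov_product w x y / K - Q \<le> gromov_product (f w) (f x) (f y)" for w x y
  proof -
    define d where "d = dist x y"
    obtain c where c: "\<forall>s\<in>{0..d}. \<bar>dist x (c s) - s\<bar> \<le> E \<and>
       dist x (c s) + dist (c s) y \<le> dist x y + E \<and>
       (\<forall>s'\<in>{0..d}. dist (c s) (c s') \<le> \<bar>s - s'\<bar> + 3 * E)"
      using path[of x y] unfolding d_def by blast
    \<comment> \<open>The position of the branch point, measured from \<open>x\<close>.\<close>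
    define s0 where "s0 = gromov_product x w y"
    have s0: "0 \<le> s0" "s0 \<le> d" unfolding s0_def d_def gromov_product_def
      using dist_triangle[of w y x] dist_triangle[of x w y] by (auto simp: dist_commute algebra_simps)
    have ox: "dist w x = gromov_product w x y + s0" and oy: "dist w y = gromov_product w x y + (d - s0)"
      unfolding s0_def d_def gromov_product_def by (simp_all add: dist_commute field_simps)
    define a where "a = gromov_product w x y / K - 2 * E / K - C"
    \<comment> \<open>The error \<open>2 * E\<close> arises on the side of \<open>y\<close>, where
      the quasi-ruler inequality and the position of \<open>c s\<close> contribute one
      \<open>E\<close> each.\<close>
    have esc: "a + \<bar>s - s0\<bar> / K \<le> dist (f w) (f (c s))" if s: "s \<in> {0..d}" for s
    proof -
      have "\<bar>dist x (c s) - s\<bar> \<le> E" "dist x (c s) + dist (c s) y \<le> d + E" using c s d_def by auto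
      moreover have "dist w x \<le> dist w (c s) + dist x (c s)" "dist w y \<le> dist w (c s) + dist (c s) y" by metric+
      ultimately have "gromov_product w x y + \<bar>s - s0\<bar> - 2 * E \<le> dist w (c s)"
        using ox oy by (auto simp: abs_if split: if_splits)
      then have "(gromov_product w x y + \<bar>s - s0\<bar> - 2 * E) / K \<le> dist w (c s) / K"
        using K by (intro divide_right_mono) auto
      also have "\<dots> \<le> dist (f w) (f (c s)) + C" using qi_embedding_onD(4)[OF f, of w "c s"] by simp
      finally show ?thesis by (simp add: a_def add_divide_distrib diff_divide_distrib)
    qed
    have lip: "dist (f (c s)) (f (c s')) \<le> K * \<bar>s - s'\<bar> + B" if "s \<in> {0..d}" "s' \<in> {0..d}" for s s'
    proof -
      have "dist (f (c s)) (f (c s')) \<le> K * dist (c s) (c s') + C" using qi_embedding_onD(3)[OF f] by simp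
      also have "\<dots> \<le> K * (\<bar>s - s'\<bar> + 3 * E) + C" using c that K by (intro add_right_mono mult_left_mono) auto
      finally show ?thesis by (simp add: B_def algebra_simps)
    qed
    obtain n where n: "d \<le> real n * L" using LB(1) reals_Archimedean3 by (metis less_imp_le)
    have right: "a - (K * L + B) - \<delta> \<le> gromov_product (f w) (f (c (s0 + 0))) (f (c (s0 + (d - s0))))"
    proof (rule gromov_product_escaping_path[OF hyp, where n = n])
      show "a + s / K \<le> dist (f w) (f (c (s0 + s)))" if "s \<in> {0..d - s0}" for s
        using esc[of "s0 + s"] that s0 by auto
      show "dist (f (c (s0 + s))) (f (c (s0 + s'))) \<le> K * \<bar>s - s'\<bar> + B"
        if "s \<in> {0..d - s0}" "s' \<in> {0..d - s0}" for s s'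
        using lip[of "s0 + s" "s0 + s'"] that s0 by auto
    qed (use K \<delta> LB n s0 in auto)
    \<comment> \<open>The other half is traversed backwards, so that it also starts at the branch
      point.\<close>
    have left: "a - (K * L + B) - \<delta> \<le> gromov_product (f w) (f (c (s0 - 0))) (f (c (s0 - s0)))"
    proof (rule gromov_product_escaping_path[OF hyp, where n = n])
      show "a + s / K \<le> dist (f w) (f (c (s0 - s)))" if "s \<in> {0..s0}" for s
        using esc[of "s0 - s"] that s0 by auto
      show "dist (f (c (s0 - s))) (f (c (s0 - s'))) \<le> K * \<bar>s - s'\<bar> + B"
        if "s \<in> {0..s0}" "s' \<in> {0..s0}" for s s'
        using lip[of "s0 - s" "s0 - s'"] that s0 by (auto simp: abs_minus_commute)
    qed (use K \<delta> LB n s0 in auto)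
    have "a - (K * L + B) - 2 * \<delta> \<le> gromov_product (f w) (f (c 0)) (f (c d))"
      using hyp[of "f w" "f (c 0)" "f (c s0)" "f (c d)"] left right
      by (simp add: gromov_product_commute[of "f w" "f (c s0)" "f (c 0)"])
    moreover have "gromov_product (f w) (f (c 0)) (f (c d)) \<le>
        gromov_product (f w) (f x) (f y) + (dist (f w) (f w) + dist (f (c 0)) (f x) + dist (f (c d)) (f y))"
      by (rule gromov_product_perturb)
    moreover have "dist (f (c 0)) (f x) \<le> K * E + C"
    proof -
      have "dist (c 0) x \<le> E" using bspec[OF c, of 0] s0 by (simp add: dist_commute)
      then have "K * dist (c 0) x \<le> K * E" using K by (intro mult_left_mono) auto
      then show ?thesis using qi_embedding_onD(3)[OF f, of "c 0" x] by simp
    qed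
    moreover have "dist (f (c d)) (f y) \<le> K * (2 * E) + C"
    proof -
      have "\<bar>dist x (c d) - d\<bar> \<le> E" "dist x (c d) + dist (c d) y \<le> d + E"
        using bspec[OF c, of d] s0 unfolding d_def by auto
      then have "dist (c d) y \<le> 2 * E" by linarith
      then have "K * dist (c d) y \<le> K * (2 * E)" using K by (intro mult_left_mono) auto
      then show ?thesis using qi_embedding_onD(3)[OF f, of "c d" y] by simp
    qed
    ultimately show ?thesis unfolding Q_def a_def dist_self by argo
  qed
  then have "gromov_product w x y \<le> K * gromov_product (f w) (f x) (f y) + K * Q" for w x y
  proof -
    have "gromov_product w x y / K \<le> gromov_product (f w) (f x) (f y) + Q"
      using \<open>\<And>w x y. gromov_product w x y / K - Q \<le> gromov_product (f w) (f x) (f y)\<close>[of w x y] by linarith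
    then show ?thesis using K by (simp add: divide_le_eq algebra_simps)
  qed
  then show ?thesis using that by blast
qed

text \<open>A relation between two maps on a common set, so that \<open>f\<close>, \<open>p\<close>
  and \<open>p' \<circ> \<Psi>\<close> can be treated alike: it is transitive, survives
  precomposition and ignores bounded changes of the maps and of the base points.\<close>

definition gromov_dominated ::
    "'a::metric_space \<Rightarrow> ('u \<Rightarrow> 'a) \<Rightarrow> 'b::metric_space \<Rightarrow> ('u \<Rightarrow> 'b) \<Rightarrow> bool" where
  "gromov_dominated x0 P x0' P' \<longleftrightarrow>
     (\<exists>K>0. \<exists>A. \<forall>u v. gromov_product x0 (P u) (P v) \<le> K * gromov_product x0' (P' u) (P' v) + A)"

lemma gromov_dominated_trans:
  assumes "gromov_dominated x0 P x0' P'" "gromov_dominated x0' P' x0'' P''"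
  shows "gromov_dominated x0 P x0'' P''"
proof -
  obtain K A where K: "K > 0"
    "\<And>u v. gromov_product x0 (P u) (P v) \<le> K * gromov_product x0' (P' u) (P' v) + A"
    using assms(1) unfolding gromov_dominated_def by blast
  obtain K' A' where K': "K' > 0"
    "\<And>u v. gromov_product x0' (P' u) (P' v) \<le> K' * gromov_product x0'' (P'' u) (P'' v) + A'"
    using assms(2) unfolding gromov_dominated_def by blast
  have "gromov_product x0 (P u) (P v) \<le> (K * K') * gromov_product x0'' (P'' u) (P'' v) + (K * A' + A)" for u v
    using K(2)[of u v] mult_left_mono[OF K'(2)[of u v], of K] K(1) by (simp add: algebra_simps)
  moreover have "0 < K * K'" using K K' by simp
  ultimately show ?thesis unfolding gromov_dominated_def by blast
qed

lemma gromov_dominated_comp: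
  assumes "gromov_dominated x0 P x0' P'"
  shows "gromov_dominated x0 (P \<circ> h) x0' (P' \<circ> h)"
proof -
  obtain K A where "K > 0"
    "\<forall>u v. gromov_product x0 (P u) (P v) \<le> K * gromov_product x0' (P' u) (P' v) + A"
    using assms unfolding gromov_dominated_def by blast
  then show ?thesis
    unfolding gromov_dominated_def by (intro exI[of _ K] conjI exI[of _ A]) auto
qed

lemma gromov_dominated_perturb:
  assumes "\<And>u. dist (P u) (P' u) \<le> M"
  shows "gromov_dominated x0 P x0' P'"
proof -
  have "gromov_product x0 (P u) (P v) \<le> 1 * gromov_product x0' (P' u) (P' v) + (dist x0 x0' + M + M)" for u v
    using gromov_product_perturb[of x0 "P u" "P v" x0' "P' u" "P' v"] assms[of u] assms[of v] by linarith
  then show ?thesis unfolding gromov_dominated_def using zero_less_one by blast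
qed

text \<open>The second bound does not follow from distance estimates: a Gromov product is a
  difference of distances, and a multiplicative error does not respect the cancellation. It is the
  first bound for a coarse inverse, composed with \<open>f\<close>.\<close>

lemma quasi_isometry_gromov_dominated:
  fixes f :: "'a::metric_space \<Rightarrow> 'b::metric_space"
  assumes "quasi_isometry f"
    and "admits_quasi_ruling D TYPE('a)" "hyperbolic_space TYPE('a)"
    and "admits_quasi_ruling D' TYPE('b)" "hyperbolic_space TYPE('b)"
  shows "gromov_dominated x0 id x0' f" and "gromov_dominated x0' f x0 id"
proof -
  \<comment> \<open>The types are left open because this is applied to \<open>f\<close> and to its
    coarse inverse.\<close>
  have *: "gromov_dominated x0 id x0' f"
    if f: "quasi_isometry f" and a: "admits_quasi_ruling D TYPE('c)" and b: "hyperbolic_space TYPE('d)"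
    for f :: "'c::metric_space \<Rightarrow> 'd::metric_space" and D x0 x0'
  proof -
    obtain K C where f: "qi_embedding_on K C UNIV f" using f by (auto simp: quasi_isometry_def)
    obtain A where A: "\<And>w x y. gromov_product w x y \<le> K * gromov_product (f w) (f x) (f y) + A"
      using qi_embedding_gromov_product[OF f a b] by blast
    have "K > 0" using qi_embedding_onD(1)[OF f] by simp
    then have "gromov_dominated x0 id (f x0) f"
      using A unfolding gromov_dominated_def id_def by blast
    moreover have "gromov_dominated (f x0) f x0' f"
      by (rule gromov_dominated_perturb[of _ _ 0]) simp
    ultimately show ?thesis by (rule gromov_dominated_trans)
  qed
  show "gromov_dominated x0 id x0' f" by (rule *[OF assms(1,2,5)])
  obtain g M where g: "quasi_isometry g" "\<And>x. dist (g (f x)) x \<le> M" "\<And>y. dist (f (g y)) y \<le> M"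
    by (rule quasi_isometry_inverse[OF assms(1)]) blast
  have "gromov_dominated x0' (id \<circ> f) x0 (g \<circ> f)"
    by (rule gromov_dominated_comp) (rule *[OF g(1) assms(4,3)])
  then have "gromov_dominated x0' f x0 (g \<circ> f)" by simp
  moreover have "gromov_dominated x0 (g \<circ> f) x0 id"
    by (rule gromov_dominated_perturb[of _ _ M]) (simp add: g)
  ultimately show "gromov_dominated x0' f x0 id" by (rule gromov_dominated_trans)
qed

section \<open>The Gromov boundary\<close>

definition boundary_rel :: "'a::metric_space \<Rightarrow> ((nat \<Rightarrow> 'a) \<times> (nat \<Rightarrow> 'a)) set" where
  "boundary_rel x0 = {(x, y). converges_to_infinity x0 x \<and> converges_to_infinity x0 y \<and>
     filterlim (\<lambda>i. gromov_product x0 (x i) (y i)) at_top sequentially}"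

lemma gromov_boundary_altdef:
  "gromov_boundary x0 = {x. converges_to_infinity x0 x} // boundary_rel x0"
  by (simp add: gromov_boundary_def boundary_rel_def)

lemma converges_to_infinity_iff:
  "converges_to_infinity x0 x \<longleftrightarrow>
     (\<forall>B. \<exists>N. \<forall>i\<ge>N. \<forall>j\<ge>N. B \<le> gromov_product x0 (x i) (x j))"
  unfolding converges_to_infinity_def filterlim_at_top eventually_prod_sequentially
  by (simp add: gromov_product_commute)

lemma boundary_rel_iff:
  "(x, y) \<in> boundary_rel x0 \<longleftrightarrow> converges_to_infinity x0 x \<and> converges_to_infinity x0 y \<and>
     (\<forall>B. \<exists>N. \<forall>i\<ge>N. B \<le> gromov_product x0 (x i) (y i))"
  unfolding boundary_rel_def filterlim_at_top eventually_sequentially by simp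

lemma boundary_rel_equiv:
  fixes x0 :: "'a::metric_space"
  assumes "hyperbolic_space TYPE('a)"
  shows "equiv {x. converges_to_infinity x0 x} (boundary_rel x0)"
proof (rule equivI)
  show "boundary_rel x0 \<subseteq> {x. converges_to_infinity x0 x} \<times> {x. converges_to_infinity x0 x}"
    by (auto simp: boundary_rel_iff)
  \<comment> \<open>Reflexivity is the diagonal \<open>i = j\<close> of the double limit.\<close>
  show "refl_on {x. converges_to_infinity x0 x} (boundary_rel x0)"
    unfolding refl_on_def boundary_rel_iff converges_to_infinity_iff by blast
  show "sym (boundary_rel x0)"
    unfolding sym_def boundary_rel_iff by (metis gromov_product_commute)
  show "trans (boundary_rel x0)"
  proof (rule transI)
    fix x y z assume xy: "(x, y) \<in> boundary_rel x0" and yz: "(y, z) \<in> boundary_rel x0"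
    obtain \<delta> where hyp: "\<And>x0 x y z::'a. gromov_product x0 x y \<ge>
        min (gromov_product x0 x z) (gromov_product x0 z y) - \<delta>"
      using assms unfolding hyperbolic_space_def by blast
    have "\<exists>N. \<forall>i\<ge>N. B \<le> gromov_product x0 (x i) (z i)" for B
    proof -
      obtain N where N: "\<forall>i\<ge>N. B + \<delta> \<le> gromov_product x0 (x i) (y i)"
        using xy unfolding boundary_rel_iff by blast
      obtain N' where N': "\<forall>i\<ge>N'. B + \<delta> \<le> gromov_product x0 (y i) (z i)"
        using yz unfolding boundary_rel_iff by blast
      have "B \<le> gromov_product x0 (x i) (z i)" if "max N N' \<le> i" for i
        using hyp[of x0 "x i" "y i" "z i"] N N' that by (smt (verit) max.bounded_iff)
      then show ?thesis by blast
    qed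
    then show "(x, z) \<in> boundary_rel x0" using xy yz unfolding boundary_rel_iff by blast
  qed
qed

lemma boundary_rel_perturb:
  assumes x: "converges_to_infinity x0 x" and M: "\<And>i. dist (x i) (y i) \<le> M"
  shows "(x, y) \<in> boundary_rel x0"
proof -
  have M0: "0 \<le> M" using M[of 0] zero_le_dist order_trans by blast
  have yy: "gromov_product x0 (x i) (x j) \<le> gromov_product x0 (y i) (y j) + 2 * M" for i j
    using gromov_product_perturb[of x0 "x i" "x j" x0 "y i" "y j"] M[of i] M[of j] by simp
  have xy: "gromov_product x0 (x i) (x i) \<le> gromov_product x0 (x i) (y i) + 2 * M" for i
    using gromov_product_perturb[of x0 "x i" "x i" x0 "x i" "y i"] M[of i] M0 by simp
  have "\<exists>N. \<forall>i\<ge>N. \<forall>j\<ge>N. B \<le> gromov_product x0 (y i) (y j)" for B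
  proof -
    obtain N where "\<forall>i\<ge>N. \<forall>j\<ge>N. B + 2 * M \<le> gromov_product x0 (x i) (x j)"
      using x unfolding converges_to_infinity_iff by blast
    then have "B \<le> gromov_product x0 (y i) (y j)" if "N \<le> i" "N \<le> j" for i j
      using yy[of i j] that by fastforce
    then show ?thesis by blast
  qed
  moreover have "\<exists>N. \<forall>i\<ge>N. B \<le> gromov_product x0 (x i) (y i)" for B
  proof -
    obtain N where "\<forall>i\<ge>N. \<forall>j\<ge>N. B + 2 * M \<le> gromov_product x0 (x i) (x j)"
      using x unfolding converges_to_infinity_iff by blast
    then have "B \<le> gromov_product x0 (x i) (y i)" if "N \<le> i" for i
      using xy[of i] that by fastforce
    then show ?thesis by blast
  qed
  ultimately show ?thesis using x unfolding boundary_rel_iff converges_to_infinity_iff by blast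
qed

text \<open>An affine bound with positive slope passes divergence on. The sequences live in the
  common domain, so the lemma serves sequences in a hyperbolic space (\<open>P = id\<close>) as well
  as samples of a ray.\<close>

lemma boundary_rel_dominated:
  assumes "gromov_dominated x0 P x0' P'" and s: "(P \<circ> s, P \<circ> s') \<in> boundary_rel x0"
  shows "(P' \<circ> s, P' \<circ> s') \<in> boundary_rel x0'"
proof -
  obtain K A where K: "K > 0"
    and dom: "\<And>u v. gromov_product x0 (P u) (P v) \<le> K * gromov_product x0' (P' u) (P' v) + A"
    using assms(1) unfolding gromov_dominated_def by blast
  have large: "B \<le> gromov_product x0' (P' u) (P' v)"
    if "K * B + A \<le> gromov_product x0 (P u) (P v)" for u v B
  proof -
    have "K * B \<le> K * gromov_product x0' (P' u) (P' v)" using dom[of u v] that by linarith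
    then show ?thesis using K by simp
  qed
  have conv: "converges_to_infinity x0' (P' \<circ> r)" if "converges_to_infinity x0 (P \<circ> r)" for r
    unfolding converges_to_infinity_iff
  proof
    fix B
    obtain N where "\<forall>i\<ge>N. \<forall>j\<ge>N. K * B + A \<le> gromov_product x0 ((P \<circ> r) i) ((P \<circ> r) j)"
      using \<open>converges_to_infinity x0 (P \<circ> r)\<close> unfolding converges_to_infinity_iff by blast
    then show "\<exists>N. \<forall>i\<ge>N. \<forall>j\<ge>N. B \<le> gromov_product x0' ((P' \<circ> r) i) ((P' \<circ> r) j)"
      using large by (intro exI[of _ N]) simp
  qed
  have "\<exists>N. \<forall>i\<ge>N. B \<le> gromov_product x0' ((P' \<circ> s) i) ((P' \<circ> s') i)" for B
  proof -
    obtain N where "\<forall>i\<ge>N. K * B + A \<le> gromov_product x0 ((P \<circ> s) i) ((P \<circ> s') i)"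
      using s unfolding boundary_rel_iff by blast
    then show ?thesis using large by (intro exI[of _ N]) simp
  qed
  then show ?thesis using s conv unfolding boundary_rel_iff by blast
qed

lemma gromov_boundary_mem_iff:
  fixes x0 :: "'a::metric_space"
  assumes "hyperbolic_space TYPE('a)" "\<xi> \<in> gromov_boundary x0" "x \<in> \<xi>"
  shows "y \<in> \<xi> \<longleftrightarrow> (x, y) \<in> boundary_rel x0"
  using quotient_eq_iff[OF boundary_rel_equiv[OF assms(1)], of \<xi> x0 \<xi> x y]
    in_quotient_imp_closed[OF boundary_rel_equiv[OF assms(1)], of \<xi> x0 x y] assms
  unfolding gromov_boundary_altdef by blast

lemma gromov_boundary_class:
  fixes x0 :: "'a::metric_space"
  assumes "hyperbolic_space TYPE('a)" "\<xi> \<in> gromov_boundary x0" "x \<in> \<xi>"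
  shows "\<xi> = boundary_rel x0 `` {x}"
  using gromov_boundary_mem_iff[OF assms] by blast

lemma gromov_boundary_classI:
  fixes x0 :: "'a::metric_space"
  assumes "hyperbolic_space TYPE('a)" "(x, y) \<in> boundary_rel x0"
  shows "boundary_rel x0 `` {x} \<in> gromov_boundary x0" "x \<in> boundary_rel x0 `` {x}"
proof -
  have x: "converges_to_infinity x0 x" using assms(2) by (simp add: boundary_rel_iff)
  then show "boundary_rel x0 `` {x} \<in> gromov_boundary x0"
    unfolding gromov_boundary_altdef by (intro quotientI) simp
  show "x \<in> boundary_rel x0 `` {x}"
    using equiv_class_self[OF boundary_rel_equiv[OF assms(1)]] x by blast
qed

lemma gromov_boundary_nonempty:
  fixes x0 :: "'a::metric_space"
  assumes "hyperbolic_space TYPE('a)" "\<xi> \<in> gromov_boundary x0"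
  obtains x where "x \<in> \<xi>" "converges_to_infinity x0 x"
  using assms in_quotient_imp_non_empty[OF boundary_rel_equiv[OF assms(1)], of \<xi> x0]
    in_quotient_imp_subset[OF boundary_rel_equiv[OF assms(1)], of \<xi> x0]
  unfolding gromov_boundary_altdef by blast


section \<open>Limit points of paths\<close>

definition diverging_times :: "(nat \<Rightarrow> real) \<Rightarrow> bool" where
  "diverging_times t \<longleftrightarrow> incseq t \<and> (\<forall>i. 0 \<le> t i) \<and> filterlim t at_top sequentially"

lemma diverging_times_real: "diverging_times real"
  unfolding diverging_times_def by (auto simp: incseq_def filterlim_real_sequentially)

lemma defines_point_iff:
  "defines_point x0 0 c \<xi> \<longleftrightarrow> \<xi> \<in> gromov_boundary x0 \<and> (\<forall>t. diverging_times t \<longrightarrow> c \<circ> t \<in> \<xi>)"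
  by (auto simp: defines_point_def diverging_times_def comp_def)

lemma defines_point_unique:
  fixes x0 :: "'a::metric_space"
  assumes "hyperbolic_space TYPE('a)" "defines_point x0 0 c \<xi>" "defines_point x0 0 c \<eta>"
  shows "\<xi> = \<eta>"
  using gromov_boundary_class[OF assms(1), of _ x0 "c \<circ> real"] diverging_times_real assms(2,3)
  unfolding defines_point_iff by metis

text \<open>With \<open>c \<circ> real\<close> as reference sequence, the boundary point disappears
  from the condition and only relations between samples remain, which
  \<open>boundary_rel_dominated\<close> can transfer. The case \<open>c' = c\<close> says that
  \<open>c\<close> defines some point.\<close>

lemma common_point_iff:
  fixes x0 :: "'a::metric_space"
  assumes "hyperbolic_space TYPE('a)"
  shows "(\<exists>\<xi>. defines_point x0 0 c \<xi> \<and> defines_point x0 0 c' \<xi>) \<longleftrightarrow>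
    (\<forall>t. diverging_times t \<longrightarrow>
      (c \<circ> real, c \<circ> t) \<in> boundary_rel x0 \<and> (c \<circ> real, c' \<circ> t) \<in> boundary_rel x0)"
    (is "?L \<longleftrightarrow> ?R")
proof
  assume ?L
  then obtain \<xi> where \<xi>: "defines_point x0 0 c \<xi>" "defines_point x0 0 c' \<xi>" by blast
  then have "\<xi> \<in> gromov_boundary x0" "c \<circ> real \<in> \<xi>"
    using diverging_times_real by (auto simp: defines_point_iff)
  from gromov_boundary_mem_iff[OF assms this] show ?R
    using \<xi> by (auto simp: defines_point_iff)
next
  assume R: ?R
  then have "(c \<circ> real, c \<circ> real) \<in> boundary_rel x0" using diverging_times_real by blast
  from gromov_boundary_classI(1)[OF assms this] show ?L
    using R unfolding defines_point_iff by blast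
qed

lemma common_point_dominated:
  fixes x0 :: "'a::metric_space" and x0' :: "'b::metric_space"
  assumes "hyperbolic_space TYPE('a)" "hyperbolic_space TYPE('b)"
    and dom: "gromov_dominated x0 P x0' P'"
    and "\<exists>\<xi>. defines_point x0 0 (P \<circ> \<gamma>) \<xi> \<and> defines_point x0 0 (P \<circ> \<gamma>') \<xi>"
  shows "\<exists>\<xi>. defines_point x0' 0 (P' \<circ> \<gamma>) \<xi> \<and> defines_point x0' 0 (P' \<circ> \<gamma>') \<xi>"
  using assms(4) boundary_rel_dominated[OF dom]
  unfolding common_point_iff[OF assms(1)] common_point_iff[OF assms(2)] comp_assoc by blast

lemma defines_point_perturb:
  fixes x0 :: "'a::metric_space"
  assumes "hyperbolic_space TYPE('a)" "defines_point x0 0 c \<xi>"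
    and M: "\<And>t. 0 \<le> t \<Longrightarrow> dist (c t) (c' t) \<le> M"
  shows "defines_point x0 0 c' \<xi>"
proof -
  have \<xi>: "\<xi> \<in> gromov_boundary x0" using assms(2) by (simp add: defines_point_iff)
  have "c' \<circ> t \<in> \<xi>" if t: "diverging_times t" for t
  proof -
    have ct: "c \<circ> t \<in> \<xi>" using assms(2) t by (simp add: defines_point_iff)
    then have "(c \<circ> t, c \<circ> t) \<in> boundary_rel x0" using gromov_boundary_mem_iff[OF assms(1) \<xi>] by blast
    then have "converges_to_infinity x0 (c \<circ> t)" by (simp add: boundary_rel_iff)
    then have "(c \<circ> t, c' \<circ> t) \<in> boundary_rel x0"
      by (rule boundary_rel_perturb) (use t M in \<open>auto simp: diverging_times_def\<close>)
    then show ?thesis using gromov_boundary_mem_iff[OF assms(1) \<xi> ct] by blast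
  qed
  then show ?thesis using \<xi> by (simp add: defines_point_iff)
qed


section \<open>The boundary homeomorphism of a quasi-isometry\<close>

text \<open>The images of the representatives of \<open>\<xi>\<close> need not fill a whole class,
  hence the saturation under the relation.\<close>

definition boundary_map ::
    "'b::metric_space \<Rightarrow> ('a \<Rightarrow> 'b) \<Rightarrow> (nat \<Rightarrow> 'a) set \<Rightarrow> (nat \<Rightarrow> 'b) set" where
  "boundary_map x0' f \<xi> = boundary_rel x0' `` ((\<circ>) f ` \<xi>)"

lemma boundary_map_class:
  fixes x0 :: "'a::metric_space" and x0' :: "'b::metric_space"
  assumes hyp: "hyperbolic_space TYPE('a)" "hyperbolic_space TYPE('b)"
    and dom: "gromov_dominated x0 id x0' f" and \<xi>: "\<xi> \<in> gromov_boundary x0" and x: "x \<in> \<xi>"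
  shows "boundary_map x0' f \<xi> \<in> gromov_boundary x0'" "f \<circ> x \<in> boundary_map x0' f \<xi>"
proof -
  have rel: "(f \<circ> x, f \<circ> y) \<in> boundary_rel x0'" if "y \<in> \<xi>" for y
    using boundary_rel_dominated[OF dom, of x y] gromov_boundary_mem_iff[OF hyp(1) \<xi> x] that by simp
  note eq = boundary_rel_equiv[OF hyp(2), of x0']
  have "boundary_map x0' f \<xi> = boundary_rel x0' `` {f \<circ> x}"
    unfolding boundary_map_def using rel x equivE[OF eq] by (auto elim: symE transE)
  then show "boundary_map x0' f \<xi> \<in> gromov_boundary x0'" "f \<circ> x \<in> boundary_map x0' f \<xi>"
    using gromov_boundary_classI[OF hyp(2) rel[OF x]] by simp_all
qed

lemma boundary_map_inverse:
  fixes x0 :: "'a::metric_space" and x0' :: "'b::metric_space"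
  assumes hyp: "hyperbolic_space TYPE('a)" "hyperbolic_space TYPE('b)"
    and dom: "gromov_dominated x0 id x0' f" "gromov_dominated x0' id x0 g"
    and M: "\<And>x. dist (g (f x)) x \<le> M" and \<xi>: "\<xi> \<in> gromov_boundary x0"
  shows "boundary_map x0 g (boundary_map x0' f \<xi>) = \<xi>"
proof -
  obtain x where x: "x \<in> \<xi>" "converges_to_infinity x0 x"
    using gromov_boundary_nonempty[OF hyp(1) \<xi>] by blast
  note f = boundary_map_class[OF hyp dom(1) \<xi> x(1)]
  note g = boundary_map_class[OF hyp(2,1) dom(2) f]
  have "(x, g \<circ> (f \<circ> x)) \<in> boundary_rel x0"
    by (rule boundary_rel_perturb[OF x(2), of _ M]) (metis M comp_apply dist_commute)
  then have "g \<circ> (f \<circ> x) \<in> \<xi>" using gromov_boundary_mem_iff[OF hyp(1) \<xi> x(1)] by blast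
  then show ?thesis
    using gromov_boundary_class[OF hyp(1) g] gromov_boundary_class[OF hyp(1) \<xi>] by metis
qed

text \<open>A boundary product is an infimum over representatives, so a lower bound on the primed
  side needs a map that takes primed representatives back to unprimed ones. For the boundary map of
  \<open>f\<close> this is a coarse inverse.\<close>

lemma boundary_product_dominated:
  assumes "0 < K" and dom: "\<And>u v. gromov_product x0 (g u) (g v) \<le> K * gromov_product x0' u v + A"
    and "\<And>x'. x' \<in> \<xi>' \<Longrightarrow> g \<circ> x' \<in> \<xi>" "\<And>y'. y' \<in> \<eta>' \<Longrightarrow> g \<circ> y' \<in> \<eta>"
    and large: "ereal (K * R + A) < boundary_product x0 \<xi> \<eta>"
  shows "ereal R \<le> boundary_product x0' \<xi>' \<eta>'"
  unfolding boundary_product_def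
proof (intro INF_greatest Liminf_bounded)
  fix x' y' assume xy: "x' \<in> \<xi>'" "y' \<in> \<eta>'"
  have "boundary_product x0 \<xi> \<eta> \<le>
      liminf (\<lambda>i. ereal (gromov_product x0 ((g \<circ> x') i) ((g \<circ> y') i)))"
    unfolding boundary_product_def using assms(3)[OF xy(1)] assms(4)[OF xy(2)]
    by (intro INF_lower2[of "g \<circ> x'"] INF_lower2[of "g \<circ> y'"] order_refl)
  with large have "ereal (K * R + A) < liminf (\<lambda>i. ereal (gromov_product x0 ((g \<circ> x') i) ((g \<circ> y') i)))"
    by (rule less_le_trans)
  from less_LiminfD[OF this]
  show "\<forall>\<^sub>F i in sequentially. ereal R \<le> ereal (gromov_product x0' (x' i) (y' i))"
  proof eventually_elim
    case (elim i)
    then have "K * R < K * gromov_product x0' (x' i) (y' i)" using dom[of "x' i" "y' i"] by simp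
    then show ?case using \<open>0 < K\<close> by simp
  qed
qed

lemma continuous_map_boundary_map:
  fixes x0 :: "'a::metric_space" and x0' :: "'b::metric_space"
  assumes hyp: "hyperbolic_space TYPE('a)" "hyperbolic_space TYPE('b)"
    and f: "gromov_dominated x0 id x0' f"
    and g: "gromov_dominated x0' id x0 g" "gromov_dominated x0 g x0' id"
    and M: "\<And>x. dist (g (f x)) x \<le> M"
  shows "continuous_map (visual_topology x0) (visual_topology x0') (boundary_map x0' f)"
proof -
  have into: "boundary_map x0' f \<xi> \<in> gromov_boundary x0'" if "\<xi> \<in> gromov_boundary x0" for \<xi>
    using boundary_map_class(1)[OF hyp f that] gromov_boundary_nonempty[OF hyp(1) that] by blast
  obtain K A where K: "K > 0"
    and dom: "\<And>u v. gromov_product x0 (g u) (g v) \<le> K * gromov_product x0' u v + A"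
    using g(2) unfolding gromov_dominated_def by auto
  have pull: "g \<circ> x' \<in> \<xi>" if "\<xi> \<in> gromov_boundary x0" "x' \<in> boundary_map x0' f \<xi>" for \<xi> x'
    using boundary_map_class(2)[OF hyp(2,1) g(1) into[OF that(1)] that(2)]
      boundary_map_inverse[OF hyp f g(1) M that(1)] by simp
  have "openin (visual_topology x0) {\<xi> \<in> gromov_boundary x0. boundary_map x0' f \<xi> \<in> V}"
    if V: "openin (visual_topology x0') V" for V
    unfolding openin_visual_topology
  proof (intro conjI ballI)
    fix \<xi> assume "\<xi> \<in> {\<xi> \<in> gromov_boundary x0. boundary_map x0' f \<xi> \<in> V}"
    then have \<xi>: "\<xi> \<in> gromov_boundary x0" "boundary_map x0' f \<xi> \<in> V" by auto
    then obtain R where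
      R: "{\<eta>' \<in> gromov_boundary x0'. boundary_product x0' (boundary_map x0' f \<xi>) \<eta>' > ereal R} \<subseteq> V"
      using V unfolding openin_visual_topology by blast
    \<comment> \<open>\<open>R + 1\<close> restores the strict inequality, as
      \<open>boundary_product_dominated\<close> yields only a weak one; the maximum makes the radius
      non-negative.\<close>
    define S where "S = max 0 (K * (R + 1) + A)"
    have "boundary_map x0' f \<eta> \<in> V"
      if \<eta>: "\<eta> \<in> gromov_boundary x0" "boundary_product x0 \<xi> \<eta> > ereal S" for \<eta>
    proof -
      have "ereal (K * (R + 1) + A) < boundary_product x0 \<xi> \<eta>"
        using \<eta>(2) by (rule le_less_trans[rotated]) (simp add: S_def)
      then have "ereal (R + 1) \<le> boundary_product x0' (boundary_map x0' f \<xi>) (boundary_map x0' f \<eta>)"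
        using boundary_product_dominated[OF K dom pull[OF \<xi>(1)] pull[OF \<eta>(1)]] by blast
      then have "ereal R < boundary_product x0' (boundary_map x0' f \<xi>) (boundary_map x0' f \<eta>)"
        by (rule less_le_trans[rotated]) simp
      then show ?thesis using R into[OF \<eta>(1)] by blast
    qed
    then show "\<exists>R\<ge>0. {\<eta> \<in> gromov_boundary x0. boundary_product x0 \<xi> \<eta> > ereal R} \<subseteq>
        {\<xi> \<in> gromov_boundary x0. boundary_map x0' f \<xi> \<in> V}"
      by (intro exI[of _ S]) (auto simp: S_def)
  qed auto
  then show ?thesis
    using into unfolding continuous_map topspace_visual_topology by auto
qed

lemma homeomorphic_map_boundary_map:
  fixes x0 :: "'a::metric_space" and x0' :: "'b::metric_space"
  assumes f: "quasi_isometry f"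
    and a: "admits_quasi_ruling D TYPE('a)" "hyperbolic_space TYPE('a)"
    and b: "admits_quasi_ruling D' TYPE('b)" "hyperbolic_space TYPE('b)"
  shows "homeomorphic_map (visual_topology x0) (visual_topology x0') (boundary_map x0' f)"
proof -
  obtain g M where g: "quasi_isometry g"
    and M: "\<And>x. dist (g (f x)) x \<le> M" "\<And>y. dist (f (g y)) y \<le> M"
    by (rule quasi_isometry_inverse[OF f]) blast
  have df: "gromov_dominated x0 id x0' f" "gromov_dominated x0' f x0 id"
    by (rule quasi_isometry_gromov_dominated[OF f a b])+
  have dg: "gromov_dominated x0' id x0 g" "gromov_dominated x0 g x0' id"
    by (rule quasi_isometry_gromov_dominated[OF g b a])+
  have "homeomorphic_maps (visual_topology x0) (visual_topology x0') (boundary_map x0' f) (boundary_map x0 g)"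
    unfolding homeomorphic_maps_def topspace_visual_topology
    using continuous_map_boundary_map[OF a(2) b(2) df(1) dg M(1)]
      continuous_map_boundary_map[OF b(2) a(2) dg(1) df M(2)]
      boundary_map_inverse[OF a(2) b(2) df(1) dg(1) M(1)]
      boundary_map_inverse[OF b(2) a(2) dg(1) df(1) M(2)] by blast
  then show ?thesis using homeomorphic_maps_map by blast
qed

section \<open>Sublinear neighbourhoods\<close>

lemma sublinear_nonneg: "sublinear \<kappa> \<Longrightarrow> 0 \<le> t \<Longrightarrow> 0 \<le> \<kappa> t"
  by (simp add: sublinear_def)

lemma sublinear_mono: "sublinear \<kappa> \<Longrightarrow> 0 \<le> s \<Longrightarrow> s \<le> t \<Longrightarrow> \<kappa> s \<le> \<kappa> t"
  using mono_onD[of "{0..}" \<kappa> s t] by (simp add: sublinear_def)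

lemma sublinear_scale:
  assumes "sublinear \<kappa>" "0 \<le> u" "u \<le> 1" "0 \<le> t"
  shows "u * \<kappa> t \<le> \<kappa> (u * t)"
proof -
  have "concave_on {0..} \<kappa>" using assms(1) by (simp add: sublinear_def)
  from concave_onD[OF this assms(2,3), of 0 t] have "(1 - u) * \<kappa> 0 + u * \<kappa> t \<le> \<kappa> (u * t)"
    using assms(4) by simp
  moreover have "0 \<le> (1 - u) * \<kappa> 0" using sublinear_nonneg[OF assms(1), of 0] assms(3) by simp
  ultimately show ?thesis by linarith
qed

lemma sublinear_subadditive:
  assumes "sublinear \<kappa>" "0 \<le> s" "0 \<le> t"
  shows "\<kappa> (s + t) \<le> \<kappa> s + \<kappa> t"
proof (cases "s + t = 0")
  case True
  then show ?thesis using assms sublinear_nonneg[OF assms(1), of 0] by (simp add: add_nonneg_eq_0_iff)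
next
  case False
  have "s / (s + t) * \<kappa> (s + t) \<le> \<kappa> s"
    using sublinear_scale[OF assms(1), of "s / (s + t)" "s + t"] assms False by (simp add: divide_le_eq)
  moreover have "t / (s + t) * \<kappa> (s + t) \<le> \<kappa> t"
    using sublinear_scale[OF assms(1), of "t / (s + t)" "s + t"] assms False by (simp add: divide_le_eq)
  moreover have "s / (s + t) * \<kappa> (s + t) + t / (s + t) * \<kappa> (s + t) = \<kappa> (s + t)"
    using False by (simp add: distrib_right[symmetric] add_divide_distrib[symmetric])
  ultimately show ?thesis by linarith
qed

text \<open>An affine change of the distance to the base point, such as a quasi-isometry causes,
  changes \<open>\<kappa>\<close> of it by at most an affine amount.\<close>

lemma sublinear_affine:
  assumes "sublinear \<kappa>" "1 \<le> L" "0 \<le> t" "0 \<le> e"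
  shows "\<kappa> (L * t + e) \<le> L * \<kappa> t + \<kappa> e"
proof -
  have "1 / L * \<kappa> (L * t) \<le> \<kappa> (1 / L * (L * t))"
    using assms by (intro sublinear_scale) auto
  then have "\<kappa> (L * t) \<le> L * \<kappa> t" using assms(2) by (simp add: divide_le_eq mult.commute)
  then show ?thesis using sublinear_subadditive[OF assms(1), of "L * t" e] assms by simp
qed

lemma sublinear_add_one: "sublinear \<kappa> \<Longrightarrow> sublinear (\<lambda>t. \<kappa> t + 1)"
proof -
  assume \<kappa>: "sublinear \<kappa>"
  have "((\<lambda>t. 1 / t) \<longlongrightarrow> (0::real)) at_top"
    by (rule tendsto_divide_0[OF tendsto_const filterlim_at_top_imp_at_infinity[OF filterlim_ident]])
  moreover have "((\<lambda>t. \<kappa> t / t) \<longlongrightarrow> 0) at_top" using \<kappa> by (simp add: sublinear_def)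
  ultimately have "((\<lambda>t. \<kappa> t / t + 1 / t) \<longlongrightarrow> 0 + 0) at_top" by (rule tendsto_add[rotated])
  then have "((\<lambda>t. (\<kappa> t + 1) / t) \<longlongrightarrow> 0) at_top" by (simp add: add_divide_distrib)
  moreover have "concave_on {0..} (\<lambda>t. \<kappa> t + 1)"
    using \<kappa> by (intro concave_on_add) (auto simp: sublinear_def concave_on_const)
  moreover have "mono_on {0..} (\<lambda>t. \<kappa> t + 1)"
    using \<kappa> by (auto simp: sublinear_def mono_on_def)
  ultimately show "sublinear (\<lambda>t. \<kappa> t + 1)" using \<kappa> by (auto simp: sublinear_def)
qed

lemma infdist_le_affine:
  assumes "Z \<noteq> {}" "0 < L" and "\<And>z. z \<in> Z \<Longrightarrow> \<exists>z'\<in>Z'. dist y' z' \<le> L * dist y z + Q"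
  shows "infdist y' Z' \<le> L * infdist y Z + Q"
proof -
  have "(infdist y' Z' - Q) / L \<le> dist y z" if z: "z \<in> Z" for z
  proof -
    obtain z' where "z' \<in> Z'" "dist y' z' \<le> L * dist y z + Q" using assms(3)[OF z] by blast
    then have "infdist y' Z' \<le> L * dist y z + Q" using infdist_le[of z' Z' y'] by linarith
    then show ?thesis using assms(2) by (simp add: divide_le_eq mult.commute)
  qed
  then have "(infdist y' Z' - Q) / L \<le> infdist y Z"
    unfolding infdist_notempty[OF assms(1)] by (intro cINF_greatest assms(1))
  then show ?thesis using assms(2) by (simp add: divide_le_eq mult.commute)
qed

lemma kappa_nbhd_mono:
  assumes "sublinear \<kappa>" "n \<le> m"
  shows "kappa_nbhd \<kappa> y0 Z n \<subseteq> kappa_nbhd \<kappa> y0 Z m"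
proof -
  have "n * \<kappa> (dist y0 y) \<le> m * \<kappa> (dist y0 y)" for y
    using sublinear_nonneg[OF assms(1)] assms(2) by (intro mult_right_mono) auto
  then show ?thesis unfolding kappa_nbhd_def by (auto intro: order_trans)
qed

text \<open>The additive errors are absorbed by the multiplicative constant; this is where
  \<open>\<kappa> 0 > 0\<close> enters.\<close>

lemma kappa_nbhd_qi_embedding:
  fixes \<Psi> :: "'a::metric_space \<Rightarrow> 'b::metric_space"
  assumes \<kappa>: "sublinear \<kappa>" "0 < \<kappa> 0" and \<Psi>: "qi_embedding_on L c UNIV \<Psi>" and "0 \<le> m" "0 \<le> M"
  obtains n where "0 \<le> n" and
    "\<And>Z Z' y y'. Z \<noteq> {} \<Longrightarrow> (\<And>z. z \<in> Z \<Longrightarrow> \<exists>z'\<in>Z'. dist (\<Psi> z) z' \<le> M) \<Longrightarrow> dist (\<Psi> y) y' \<le> M \<Longrightarrow>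
       y \<in> kappa_nbhd \<kappa> y0 Z m \<Longrightarrow> y' \<in> kappa_nbhd \<kappa> y0' Z' n"
proof -
  have L: "1 \<le> L" "0 \<le> c" using qi_embedding_onD(1,2)[OF \<Psi>] by auto
  \<comment> \<open>The additive error in \<open>dist y0 y \<le> L * dist y0' y' + e\<close>. It
    contains the distance from \<open>\<Psi> y0\<close> to \<open>y0'\<close>, so the base points
    may be unrelated. Neither \<open>e\<close> nor \<open>n\<close> depends on \<open>Z\<close> or
    \<open>y\<close>, which keeps the Morse bounds uniform.\<close>
  define e where "e = L * (dist y0' (\<Psi> y0) + M + c)"
  have e: "0 \<le> e" using L \<open>0 \<le> M\<close> by (simp add: e_def)
  define n where "n = L * m * (L + \<kappa> e / \<kappa> 0) + (2 * M + c) / \<kappa> 0"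
  have "0 \<le> n" using L e \<kappa> \<open>0 \<le> m\<close> \<open>0 \<le> M\<close> sublinear_nonneg[OF \<kappa>(1) e] by (simp add: n_def)
  moreover have "y' \<in> kappa_nbhd \<kappa> y0' Z' n"
    if "Z \<noteq> {}" and Z: "\<And>z. z \<in> Z \<Longrightarrow> \<exists>z'\<in>Z'. dist (\<Psi> z) z' \<le> M"
      and y: "dist (\<Psi> y) y' \<le> M" "y \<in> kappa_nbhd \<kappa> y0 Z m" for Z Z' y y'
  proof -
    have "infdist y' Z' \<le> L * infdist y Z + (2 * M + c)"
    proof (rule infdist_le_affine[OF \<open>Z \<noteq> {}\<close>])
      fix z assume "z \<in> Z"
      then obtain z' where "z' \<in> Z'" "dist (\<Psi> z) z' \<le> M" using Z by blast
      moreover have "dist y' z' \<le> dist (\<Psi> y) y' + dist (\<Psi> y) (\<Psi> z) + dist (\<Psi> z) z'" by metric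
      moreover have "dist (\<Psi> y) (\<Psi> z) \<le> L * dist y z + c" using qi_embedding_onD(3)[OF \<Psi>] by simp
      ultimately show "\<exists>z'\<in>Z'. dist y' z' \<le> L * dist y z + (2 * M + c)"
        using y(1) by (intro bexI[of _ z']) linarith+
    qed (use L in simp)
    also have "L * infdist y Z \<le> L * (m * \<kappa> (dist y0 y))"
      using y(2) L by (simp add: kappa_nbhd_def)
    also have "\<kappa> (dist y0 y) \<le> L * \<kappa> (dist y0' y') + \<kappa> e"
    proof -
      have "dist y0 y \<le> L * (dist (\<Psi> y0) (\<Psi> y) + c)"
        using qi_embedding_onD(5)[OF \<Psi>] by simp
      also have "\<dots> \<le> L * (dist y0' y' + dist y0' (\<Psi> y0) + M + c)"
      proof -
        have "dist (\<Psi> y0) (\<Psi> y) \<le> dist y0' y' + dist y0' (\<Psi> y0) + dist (\<Psi> y) y'" by metric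
        then show ?thesis using y(1) L by (intro mult_left_mono) auto
      qed
      also have "\<dots> = L * dist y0' y' + e" by (simp add: e_def algebra_simps)
      finally have "\<kappa> (dist y0 y) \<le> \<kappa> (L * dist y0' y' + e)" by (intro sublinear_mono[OF \<kappa>(1)]) auto
      also have "\<dots> \<le> L * \<kappa> (dist y0' y') + \<kappa> e" using L e by (intro sublinear_affine[OF \<kappa>(1)]) auto
      finally show ?thesis .
    qed
    also have "L * (m * (L * \<kappa> (dist y0' y') + \<kappa> e)) + (2 * M + c) \<le> n * \<kappa> (dist y0' y')"
    proof -
      have "1 \<le> \<kappa> (dist y0' y') / \<kappa> 0" using sublinear_mono[OF \<kappa>(1), of 0 "dist y0' y'"] \<kappa>(2) by simp
      then have *: "r \<le> r / \<kappa> 0 * \<kappa> (dist y0' y')" if "0 \<le> r" for r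
        using mult_left_mono[of 1 "\<kappa> (dist y0' y') / \<kappa> 0" r] that by simp
      have "L * (m * (L * \<kappa> (dist y0' y') + \<kappa> e)) \<le>
          L * (m * (L * \<kappa> (dist y0' y') + \<kappa> e / \<kappa> 0 * \<kappa> (dist y0' y')))"
        using *[OF sublinear_nonneg[OF \<kappa>(1) e]] L \<open>0 \<le> m\<close> by (intro mult_left_mono add_left_mono) auto
      moreover have "2 * M + c \<le> (2 * M + c) / \<kappa> 0 * \<kappa> (dist y0' y')" using * L \<open>0 \<le> M\<close> by simp
      ultimately show ?thesis by (simp add: n_def algebra_simps)
    qed
    finally show ?thesis
      using L \<open>0 \<le> m\<close> by (simp add: kappa_nbhd_def mult_left_mono)
  qed
  ultimately show ?thesis using that by blast
qed


section \<open>Morse rays under quasi-isometries\<close>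

lemma kappa_Morse_iff:
  "kappa_Morse \<kappa> y0 Z \<longleftrightarrow> (\<forall>K\<ge>1. \<forall>C\<ge>0. \<exists>n\<ge>0. \<forall>a b \<beta>.
     quasi_geodesic_segment K C a b \<beta> \<and> \<beta> a \<in> Z \<and> \<beta> b \<in> Z \<longrightarrow> \<beta> ` {a..b} \<subseteq> kappa_nbhd \<kappa> y0 Z n)"
    (is "_ \<longleftrightarrow> (\<forall>K\<ge>1. \<forall>C\<ge>0. \<exists>n\<ge>0. ?P K C n)")
proof
  assume ex: "\<forall>K\<ge>1. \<forall>C\<ge>0. \<exists>n\<ge>0. ?P K C n"
  define \<mu> where "\<mu> K C = (SOME n. 0 \<le> n \<and> ?P K C n)" for K C
  have "0 \<le> \<mu> K C \<and> ?P K C (\<mu> K C)" if "1 \<le> K" "0 \<le> C" for K C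
    unfolding \<mu>_def by (rule someI_ex) (use ex that in simp)
  then show "kappa_Morse \<kappa> y0 Z" unfolding kappa_Morse_def by (intro exI[of _ \<mu>]) simp
next
  assume "kappa_Morse \<kappa> y0 Z"
  then obtain \<mu> where "\<forall>K\<ge>1. \<forall>C\<ge>0. 0 \<le> \<mu> K C \<and> ?P K C (\<mu> K C)"
    unfolding kappa_Morse_def by (elim exE)
  then show "\<forall>K\<ge>1. \<forall>C\<ge>0. \<exists>n\<ge>0. ?P K C n"
    by (intro allI impI, rule_tac x = "\<mu> K C" in exI) simp
qed

lemma kappa_Morse_mono:
  assumes "kappa_Morse \<kappa> y0 Z"
    and sub: "\<And>n. 0 \<le> n \<Longrightarrow> \<exists>m\<ge>0. kappa_nbhd \<kappa> y0 Z n \<subseteq> kappa_nbhd \<kappa>' y0 Z m"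
  shows "kappa_Morse \<kappa>' y0 Z"
  unfolding kappa_Morse_iff
proof (intro allI impI)
  fix K C :: real assume "1 \<le> K" "0 \<le> C"
  then obtain n where n: "0 \<le> n" "\<forall>a b \<beta>. quasi_geodesic_segment K C a b \<beta> \<and> \<beta> a \<in> Z \<and> \<beta> b \<in> Z \<longrightarrow>
      \<beta> ` {a..b} \<subseteq> kappa_nbhd \<kappa> y0 Z n"
    using assms(1) unfolding kappa_Morse_iff by blast
  obtain m where "0 \<le> m" "kappa_nbhd \<kappa> y0 Z n \<subseteq> kappa_nbhd \<kappa>' y0 Z m" using sub[OF n(1)] by blast
  then show "\<exists>n\<ge>0. \<forall>a b \<beta>. quasi_geodesic_segment K C a b \<beta> \<and> \<beta> a \<in> Z \<and> \<beta> b \<in> Z \<longrightarrow>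
      \<beta> ` {a..b} \<subseteq> kappa_nbhd \<kappa>' y0 Z n"
    using n(2) by (intro exI[of _ m]) blast
qed

text \<open>The coarse inverse \<open>\<Phi>\<close> below is adapted to \<open>Z\<close>: it maps \<open>Z'\<close> into \<open>Z\<close>, so that it takes
  quasi-geodesics with end points on \<open>Z'\<close> to quasi-geodesics with end points on \<open>Z\<close>.\<close>

lemma kappa_Morse_quasi_isometry:
  fixes \<Psi> :: "'a::metric_space \<Rightarrow> 'b::metric_space"
  assumes \<kappa>: "sublinear \<kappa>" "0 < \<kappa> 0" and "quasi_isometry \<Psi>" and Morse: "kappa_Morse \<kappa> y0 Z"
    and "Z \<noteq> {}" and Z: "\<And>z. z \<in> Z \<Longrightarrow> \<exists>z'\<in>Z'. dist (\<Psi> z) z' \<le> M"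
    and Z': "\<And>z'. z' \<in> Z' \<Longrightarrow> \<exists>z\<in>Z. dist (\<Psi> z) z' \<le> M"
  shows "kappa_Morse \<kappa> y0' Z'"
proof -
  obtain L c where \<Psi>: "qi_embedding_on L c UNIV \<Psi>"
    using assms(3) by (auto simp: quasi_isometry_def)
  obtain s R where s: "\<And>y. dist (\<Psi> (s y)) y \<le> R"
    by (rule quasi_isometry_section[OF assms(3)]) blast
  \<comment> \<open>\<open>M\<close> bounds the error of the inverse on \<open>Z'\<close>, where a
    point of \<open>Z\<close> is chosen, and \<open>R\<close> bounds it elsewhere.\<close>
  define N where "N = max M R"
  have N: "M \<le> N" "R \<le> N" by (auto simp: N_def)
  have N0: "0 \<le> N" using s[of undefined] N(2) zero_le_dist[of "\<Psi> (s undefined)" undefined] by linarith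
  have "\<exists>y. dist (\<Psi> y) y' \<le> N \<and> (y' \<in> Z' \<longrightarrow> y \<in> Z)" for y'
  proof (cases "y' \<in> Z'")
    case True
    then obtain z where "z \<in> Z" "dist (\<Psi> z) y' \<le> M" using Z' by blast
    moreover from this have "dist (\<Psi> z) y' \<le> N" using N(1) by linarith
    ultimately show ?thesis by blast
  next
    case False
    moreover have "dist (\<Psi> (s y')) y' \<le> N" using s[of y'] N(2) by linarith
    ultimately show ?thesis by blast
  qed
  then obtain \<Phi> where \<Phi>: "\<And>y'. dist (\<Psi> (\<Phi> y')) y' \<le> N" "\<And>y'. y' \<in> Z' \<Longrightarrow> \<Phi> y' \<in> Z"
    by metis
  note q = coarse_section(1)[OF \<Psi> \<Phi>(1)]
  show ?thesis
    unfolding kappa_Morse_iff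
  proof (intro allI impI)
    fix K C :: real assume KC: "1 \<le> K" "0 \<le> C"
    define C1 where "C1 = L * C + L * (2 * N + c)"
    have L: "1 \<le> L" "0 \<le> c" using qi_embedding_onD(1,2)[OF \<Psi>] by auto
    have "1 \<le> K * L" using mult_mono[of 1 K 1 L] KC L by simp
    moreover have "0 \<le> C1" using KC L N0 by (simp add: C1_def)
    ultimately obtain m where m: "0 \<le> m"
      "\<And>a b \<beta>. quasi_geodesic_segment (K * L) C1 a b \<beta> \<and> \<beta> a \<in> Z \<and> \<beta> b \<in> Z \<Longrightarrow>
         \<beta> ` {a..b} \<subseteq> kappa_nbhd \<kappa> y0 Z m"
      using Morse unfolding kappa_Morse_iff by blast
    obtain n where n: "0 \<le> n" "\<And>Z Z' y y'. Z \<noteq> {} \<Longrightarrow>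
        (\<And>z. z \<in> Z \<Longrightarrow> \<exists>z'\<in>Z'. dist (\<Psi> z) z' \<le> N) \<Longrightarrow> dist (\<Psi> y) y' \<le> N \<Longrightarrow>
        y \<in> kappa_nbhd \<kappa> y0 Z m \<Longrightarrow> y' \<in> kappa_nbhd \<kappa> y0' Z' n"
      by (rule kappa_nbhd_qi_embedding[OF \<kappa> \<Psi> m(1) N0]) blast
    have ZN: "\<exists>z'\<in>Z'. dist (\<Psi> z) z' \<le> N" if "z \<in> Z" for z
      using Z[OF that] N(1) by (meson order_trans)
    have "\<beta> ` {a..b} \<subseteq> kappa_nbhd \<kappa> y0' Z' n"
      if \<beta>: "quasi_geodesic_segment K C a b \<beta>" "\<beta> a \<in> Z'" "\<beta> b \<in> Z'" for a b \<beta>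
    proof -
      have "quasi_geodesic_segment (K * L) C1 a b (\<Phi> \<circ> \<beta>)"
        using \<beta>(1) qi_embedding_on_comp[OF _ q] unfolding quasi_geodesic_segment_def C1_def by blast
      then have "(\<Phi> \<circ> \<beta>) ` {a..b} \<subseteq> kappa_nbhd \<kappa> y0 Z m"
        using \<beta>(2,3) \<Phi>(2) by (intro m(2)) simp
      then show ?thesis using n(2)[OF \<open>Z \<noteq> {}\<close> ZN \<Phi>(1)] by auto
    qed
    then show "\<exists>n\<ge>0. \<forall>a b \<beta>. quasi_geodesic_segment K C a b \<beta> \<and> \<beta> a \<in> Z' \<and> \<beta> b \<in> Z' \<longrightarrow>
        \<beta> ` {a..b} \<subseteq> kappa_nbhd \<kappa> y0' Z' n"
      using n(1) by blast
  qed
qed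

text \<open>The bounded error gives two uses: \<open>M = 0\<close> treats
  \<open>\<Psi> \<circ> \<gamma>\<close>, and the identity as \<open>\<Psi>\<close> treats a bounded
  change of a ray. A quasi-geodesic near \<open>Z'\<close> is tested by its image under a coarse
  inverse.\<close>

lemma kappa_rays_quasi_isometry:
  fixes \<Psi> :: "'a::metric_space \<Rightarrow> 'b::metric_space"
  assumes \<kappa>: "sublinear \<kappa>" "0 < \<kappa> 0" and "quasi_isometry \<Psi>" and \<gamma>: "\<gamma> \<in> kappa_rays \<kappa> y0"
    and M: "\<And>t. 0 \<le> t \<Longrightarrow> dist (\<Psi> (\<gamma> t)) (\<gamma>' t) \<le> M"
  shows "\<gamma>' \<in> kappa_rays \<kappa> y0'"
proof -
  have M0: "0 \<le> M" using M[of 0] zero_le_dist[of "\<Psi> (\<gamma> 0)" "\<gamma>' 0"] by linarith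
  obtain L c where \<Psi>: "qi_embedding_on L c UNIV \<Psi>"
    using assms(3) by (auto simp: quasi_isometry_def)
  obtain K C where "qi_embedding_on K C {0..} \<gamma>"
    using \<gamma> by (auto simp: kappa_rays_def quasi_geodesic_ray_def)
  then have "qi_embedding_on (K * L) (L * C + c) {0..} (\<Psi> \<circ> \<gamma>)"
    using qi_embedding_on_comp \<Psi> by blast
  then have "qi_embedding_on (K * L) (L * C + c + 2 * M) {0..} \<gamma>'"
    by (rule qi_embedding_on_perturb) (use M M0 in auto)
  then have "quasi_geodesic_ray \<gamma>'" unfolding quasi_geodesic_ray_def by blast
  moreover have "kappa_Morse \<kappa> y0' (\<gamma>' ` {0..})"
  proof (rule kappa_Morse_quasi_isometry[OF \<kappa> assms(3), where Z = "\<gamma> ` {0..}" and M = M])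
    show "kappa_Morse \<kappa> y0 (\<gamma> ` {0..})" using \<gamma> by (simp add: kappa_rays_def)
  qed (use M in auto)
  ultimately show ?thesis by (simp add: kappa_rays_def)
qed

lemma kappa_close_qi_embedding_imp:
  fixes \<Psi> :: "'a::metric_space \<Rightarrow> 'b::metric_space"
  assumes \<kappa>: "sublinear \<kappa>" "0 < \<kappa> 0" and \<Psi>: "qi_embedding_on L c UNIV \<Psi>"
    and M: "\<And>t. 0 \<le> t \<Longrightarrow> dist (\<Psi> (\<gamma>1 t)) (\<gamma>1' t) \<le> M" "\<And>t. 0 \<le> t \<Longrightarrow> dist (\<Psi> (\<gamma>2 t)) (\<gamma>2' t) \<le> M"
    and close: "kappa_close \<kappa> y0 \<gamma>1 \<gamma>2"
  shows "kappa_close \<kappa> y0' \<gamma>1' \<gamma>2'"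
proof -
  have M0: "0 \<le> M" using M(1)[of 0] zero_le_dist[of "\<Psi> (\<gamma>1 0)" "\<gamma>1' 0"] by linarith
  have *: "\<exists>n. \<alpha>' ` {0..} \<subseteq> kappa_nbhd \<kappa> y0' (\<beta>' ` {0..}) n"
    if "\<exists>n. \<alpha> ` {0..} \<subseteq> kappa_nbhd \<kappa> y0 (\<beta> ` {0..}) n"
      and \<alpha>: "\<And>t. 0 \<le> t \<Longrightarrow> dist (\<Psi> (\<alpha> t)) (\<alpha>' t) \<le> M"
      and \<beta>: "\<And>t. 0 \<le> t \<Longrightarrow> dist (\<Psi> (\<beta> t)) (\<beta>' t) \<le> M" for \<alpha> \<alpha>' \<beta> \<beta>' :: "real \<Rightarrow> _"
  proof -
    obtain m where "\<alpha> ` {0..} \<subseteq> kappa_nbhd \<kappa> y0 (\<beta> ` {0..}) m" using \<open>\<exists>n. _ n\<close> by blast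
    \<comment> \<open>Closeness puts no sign on its constant, while
      \<open>kappa_nbhd_qi_embedding\<close> expects a non-negative one.\<close>
    then have m: "\<alpha> ` {0..} \<subseteq> kappa_nbhd \<kappa> y0 (\<beta> ` {0..}) (max m 0)"
      using kappa_nbhd_mono[OF \<kappa>(1), of m "max m 0"] by force
    obtain n where n: "\<And>Z Z' y y'. Z \<noteq> {} \<Longrightarrow>
        (\<And>z. z \<in> Z \<Longrightarrow> \<exists>z'\<in>Z'. dist (\<Psi> z) z' \<le> M) \<Longrightarrow> dist (\<Psi> y) y' \<le> M \<Longrightarrow>
        y \<in> kappa_nbhd \<kappa> y0 Z (max m 0) \<Longrightarrow> y' \<in> kappa_nbhd \<kappa> y0' Z' n"
      by (rule kappa_nbhd_qi_embedding[OF \<kappa> \<Psi> _ M0, of "max m 0"]) auto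
    have "\<alpha>' t \<in> kappa_nbhd \<kappa> y0' (\<beta>' ` {0..}) n" if "0 \<le> t" for t
      by (rule n[of "\<beta> ` {0..}" _ "\<alpha> t"]) (use \<alpha> \<beta> m that in auto)
    then show ?thesis by (intro exI[of _ n]) auto
  qed
  have "\<exists>n. \<gamma>1' ` {0..} \<subseteq> kappa_nbhd \<kappa> y0' (\<gamma>2' ` {0..}) n"
    by (rule *[OF _ M]) (use close in \<open>simp add: kappa_close_def\<close>)
  moreover have "\<exists>n. \<gamma>2' ` {0..} \<subseteq> kappa_nbhd \<kappa> y0' (\<gamma>1' ` {0..}) n"
    by (rule *[OF _ M(2,1)]) (use close in \<open>simp add: kappa_close_def\<close>)
  ultimately show ?thesis by (simp add: kappa_close_def)
qed

text \<open>The converse is the forward implication for a coarse section: it takes the primed rays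
  back to within bounded distance of the original ones, which the formulation with errors
  admits.\<close>

lemma kappa_close_quasi_isometry_iff:
  fixes \<Psi> :: "'a::metric_space \<Rightarrow> 'b::metric_space"
  assumes \<kappa>: "sublinear \<kappa>" "0 < \<kappa> 0" and "quasi_isometry \<Psi>"
    and M: "\<And>t. 0 \<le> t \<Longrightarrow> dist (\<Psi> (\<gamma>1 t)) (\<gamma>1' t) \<le> M" "\<And>t. 0 \<le> t \<Longrightarrow> dist (\<Psi> (\<gamma>2 t)) (\<gamma>2' t) \<le> M"
  shows "kappa_close \<kappa> y0 \<gamma>1 \<gamma>2 \<longleftrightarrow> kappa_close \<kappa> y0' \<gamma>1' \<gamma>2'"
proof
  obtain L c where \<Psi>: "qi_embedding_on L c UNIV \<Psi>"
    using assms(3) by (auto simp: quasi_isometry_def)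
  show "kappa_close \<kappa> y0' \<gamma>1' \<gamma>2'" if "kappa_close \<kappa> y0 \<gamma>1 \<gamma>2"
    using kappa_close_qi_embedding_imp[OF \<kappa> \<Psi> M that] .
  assume close: "kappa_close \<kappa> y0' \<gamma>1' \<gamma>2'"
  obtain \<Phi> R where \<Phi>: "\<And>y. dist (\<Psi> (\<Phi> y)) y \<le> R"
    by (rule quasi_isometry_section[OF assms(3)]) blast
  have near: "dist (\<Phi> y') y \<le> L * (R + M + c)" if "dist (\<Psi> y) y' \<le> M" for y y'
  proof -
    have "dist (\<Phi> y') y \<le> L * (dist (\<Psi> (\<Phi> y')) (\<Psi> y) + c)"
      using qi_embedding_onD(5)[OF \<Psi>] by simp
    also have "dist (\<Psi> (\<Phi> y')) (\<Psi> y) \<le> R + M" using \<Phi>[of y'] that by metric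
    finally show ?thesis using qi_embedding_onD(1)[OF \<Psi>] by (simp add: mult_left_mono)
  qed
  show "kappa_close \<kappa> y0 \<gamma>1 \<gamma>2"
    by (rule kappa_close_qi_embedding_imp[where \<Psi> = \<Phi>, OF \<kappa> coarse_section(1)[OF \<Psi> \<Phi>] _ _ close])
      (rule near, rule M, assumption)+
qed

lemma quasi_isometry_id: "quasi_isometry (\<lambda>y. y)"
proof -
  have "qi_embedding_on 1 0 UNIV (\<lambda>y. y)" by (simp add: qi_embedding_on_def)
  moreover have "coarsely_dense (range (\<lambda>y. y))"
    unfolding coarsely_dense_def by (intro exI[of _ 0] allI) (auto intro: bexI)
  ultimately show ?thesis unfolding quasi_isometry_def by blast
qed

section \<open>Invariance of \<open>\<kappa>\<close>-injectivity\<close>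

lemma kappa_injective_dominated:
  fixes x0 :: "'a::metric_space" and x0' :: "'b::metric_space"
  assumes hyp: "hyperbolic_space TYPE('a)" "hyperbolic_space TYPE('b)"
    and dom: "gromov_dominated x0 P x0' P'" "gromov_dominated x0' P' x0 P"
    and inj: "kappa_injective \<kappa> y0 x0 P"
  shows "kappa_injective \<kappa> y0 x0' P'"
proof -
  have *: "(\<exists>\<xi>. defines_point x0 0 (P \<circ> \<gamma>) \<xi> \<and> defines_point x0 0 (P \<circ> \<gamma>') \<xi>) \<longleftrightarrow>
      (\<exists>\<xi>. defines_point x0' 0 (P' \<circ> \<gamma>) \<xi> \<and> defines_point x0' 0 (P' \<circ> \<gamma>') \<xi>)" for \<gamma> \<gamma>'
    using common_point_dominated[OF hyp dom(1)] common_point_dominated[OF hyp(2,1) dom(2)] by (rule iffI)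
  have "(\<exists>\<xi>. defines_point x0 0 (P \<circ> \<gamma>) \<xi>) \<longleftrightarrow> (\<exists>\<xi>. defines_point x0' 0 (P' \<circ> \<gamma>) \<xi>)" for \<gamma>
    using *[of \<gamma> \<gamma>] by simp
  then show ?thesis using inj unfolding kappa_injective_def by (simp add: *)
qed

lemma kappa_injective_comp_quasi_isometry:
  assumes \<kappa>: "sublinear \<kappa>" "0 < \<kappa> 0" and \<Psi>: "quasi_isometry \<Psi>"
    and inj: "kappa_injective \<kappa> y0' x0' p'"
  shows "kappa_injective \<kappa> y0 x0' (p' \<circ> \<Psi>)"
proof -
  have rays: "\<Psi> \<circ> \<gamma> \<in> kappa_rays \<kappa> y0'" if "\<gamma> \<in> kappa_rays \<kappa> y0" for \<gamma>
    by (rule kappa_rays_quasi_isometry[OF \<kappa> \<Psi> that, of _ 0]) simp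
  have close: "kappa_close \<kappa> y0 \<gamma> \<gamma>' \<longleftrightarrow> kappa_close \<kappa> y0' (\<Psi> \<circ> \<gamma>) (\<Psi> \<circ> \<gamma>')" for \<gamma> \<gamma>'
    by (rule kappa_close_quasi_isometry_iff[OF \<kappa> \<Psi>, of _ _ 0]) simp_all
  show ?thesis
    using inj rays unfolding kappa_injective_def close comp_assoc by blast
qed

section \<open>The degenerate case: there are no Morse rays if \<open>\<kappa>\<close> vanishes
  identically\<close>

text \<open>A segment may jump away from \<open>Z\<close> and back, so a Morse set comes close to every point.\<close>

lemma kappa_Morse_infdist:
  fixes Z :: "'a::metric_space set"
  assumes "kappa_Morse \<kappa> y0 Z" "z \<in> Z"
  obtains n where "0 \<le> n" "infdist y Z \<le> n * \<kappa> (dist y0 y)"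
proof -
  \<comment> \<open>With this additive constant the jumps of \<open>\<beta>\<close> satisfy the
    upper bound; the summand 1 makes the lower bound trivial on an interval of length 1.\<close>
  define C where "C = dist z y + 1"
  define \<beta> where "\<beta> t = (if t = 1 / 2 then y else z)" for t :: real
  have "dist (\<beta> s) (\<beta> t) \<le> 1 * dist s t + C \<and> dist s t / 1 - C \<le> dist (\<beta> s) (\<beta> t)"
    if "s \<in> {0..1}" "t \<in> {0..1}" for s t
  proof -
    have "dist (\<beta> s) (\<beta> t) \<le> C" by (simp add: \<beta>_def C_def dist_commute)
    moreover have "dist s t \<le> 1" using that by (auto simp: dist_real_def)
    moreover have "1 \<le> C" by (simp add: C_def)
    moreover have "0 \<le> dist s t" "0 \<le> dist (\<beta> s) (\<beta> t)" by simp_all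
    ultimately show ?thesis by linarith
  qed
  then have \<beta>: "quasi_geodesic_segment 1 C 0 1 \<beta>"
    by (simp add: quasi_geodesic_segment_def qi_embedding_on_def C_def)
  have "0 \<le> C" by (simp add: C_def)
  then obtain n where n: "0 \<le> n" "\<And>a b \<beta>. quasi_geodesic_segment 1 C a b \<beta> \<and> \<beta> a \<in> Z \<and> \<beta> b \<in> Z \<Longrightarrow>
      \<beta> ` {a..b} \<subseteq> kappa_nbhd \<kappa> y0 Z n"
    using assms(1) unfolding kappa_Morse_iff by (meson order_refl)
  have "\<beta> ` {0..1} \<subseteq> kappa_nbhd \<kappa> y0 Z n"
    using \<beta> assms(2) by (intro n(2)) (simp add: \<beta>_def)
  then have "\<beta> (1 / 2) \<in> kappa_nbhd \<kappa> y0 Z n" by auto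
  then show ?thesis using n(1) that by (simp add: \<beta>_def kappa_nbhd_def)
qed

text \<open>Homogeneity moves a far point of the ray to its beginning; the moved ray then runs in from far
  away and out again along the same coarsely dense ray, so it passes close to its own initial point at a
  late time, which a quasi-geodesic cannot do.\<close>

lemma no_coarsely_dense_ray:
  fixes \<gamma> :: "real \<Rightarrow> 'a::metric_space"
  assumes homogeneous: "\<And>x y::'a. \<exists>h::'a \<Rightarrow> 'a. (\<forall>u v. dist (h u) (h v) = dist u v) \<and> dist (h x) y \<le> M"
    and \<gamma>: "qi_embedding_on K C {0..} \<gamma>" and dense: "\<And>y. \<exists>t\<ge>0. dist y (\<gamma> t) \<le> 1"
  shows False
proof -
  have K: "1 \<le> K" "0 \<le> C" using qi_embedding_onD(1,2)[OF \<gamma>] by auto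
  obtain \<rho> where \<rho>: "\<And>y. 0 \<le> \<rho> y" "\<And>y. dist y (\<gamma> (\<rho> y)) \<le> 1" using dense by metis
  \<comment> \<open>\<open>J\<close> bounds the change of \<open>h\<close> over unit time, and
    \<open>E\<close> bounds \<open>h T\<close>, because \<open>g (\<gamma> T)\<close> is within
    \<open>M\<close> of \<open>\<gamma> 0\<close>. \<open>T\<close> is so large that times at least
    \<open>T\<close> apart have \<open>h\<close>-values differing by more than \<open>J\<close> and
    more than \<open>E\<close>.\<close>
  define J where "J = K * (K + 2 * C + 2)"
  define E where "E = K * (M + 1 + C)"
  define T where "T = max (K * (K * J + 2 * C + 2)) (K * (K * E + 2 * C + 2)) + 1"
  have J: "0 \<le> J" using K by (simp add: J_def)
  have T: "0 \<le> T" using K J by (simp add: T_def le_max_iff_disj)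
  obtain g :: "'a \<Rightarrow> 'a" where iso: "\<And>u v. dist (g u) (g v) = dist u v" and gT: "dist (g (\<gamma> T)) (\<gamma> 0) \<le> M"
    using homogeneous by blast
  define h where "h t = \<rho> (g (\<gamma> t))" for t
  have h0: "0 \<le> h t" for t by (simp add: h_def \<rho>)
  have h_near: "dist (g (\<gamma> t)) (\<gamma> (h t)) \<le> 1" for t by (simp add: h_def \<rho>)
  have upper: "\<bar>h s - h t\<bar> \<le> J" if "0 \<le> s" "0 \<le> t" "\<bar>s - t\<bar> \<le> 1" for s t
  proof -
    have "\<bar>h s - h t\<bar> \<le> K * (dist (\<gamma> (h s)) (\<gamma> (h t)) + C)"
      using qi_embedding_onD(5)[OF \<gamma>, of "h s" "h t"] h0 by (simp add: dist_real_def)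
    also have "dist (\<gamma> (h s)) (\<gamma> (h t)) \<le> dist (g (\<gamma> s)) (g (\<gamma> t)) + 2"
      using h_near[of s] h_near[of t] by metric
    also have "dist (g (\<gamma> s)) (g (\<gamma> t)) \<le> K * \<bar>s - t\<bar> + C"
      using qi_embedding_onD(3)[OF \<gamma>, of s t] that by (simp add: iso dist_real_def)
    also have "K * \<bar>s - t\<bar> \<le> K * 1" using that K by (intro mult_left_mono) auto
    finally have "\<bar>h s - h t\<bar> \<le> K * (K * 1 + C + 2 + C)" using K by simp
    then show ?thesis by (simp add: J_def algebra_simps)
  qed
  have lower: "\<bar>s - t\<bar> \<le> K * (K * \<bar>h s - h t\<bar> + 2 * C + 2)" if "0 \<le> s" "0 \<le> t" for s t
  proof -
    have "\<bar>s - t\<bar> \<le> K * (dist (g (\<gamma> s)) (g (\<gamma> t)) + C)"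
      using qi_embedding_onD(5)[OF \<gamma>, of s t] that by (simp add: iso dist_real_def)
    also have "dist (g (\<gamma> s)) (g (\<gamma> t)) \<le> dist (\<gamma> (h s)) (\<gamma> (h t)) + 2"
      using h_near[of s] h_near[of t] by metric
    also have "dist (\<gamma> (h s)) (\<gamma> (h t)) \<le> K * \<bar>h s - h t\<bar> + C"
      using qi_embedding_onD(3)[OF \<gamma>, of "h s" "h t"] h0 by (simp add: dist_real_def)
    finally have "\<bar>s - t\<bar> \<le> K * (K * \<bar>h s - h t\<bar> + C + 2 + C)" using K by simp
    then show ?thesis by (simp add: algebra_simps)
  qed
  have far: "r < \<bar>h s - h t\<bar>" if "0 \<le> s" "0 \<le> t" "K * (K * r + 2 * C + 2) < \<bar>s - t\<bar>" for r s t
  proof (rule ccontr)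
    assume "\<not> r < \<bar>h s - h t\<bar>"
    then have "K * (K * \<bar>h s - h t\<bar> + 2 * C + 2) \<le> K * (K * r + 2 * C + 2)"
      using K by (intro mult_left_mono add_right_mono) auto
    then show False using lower[OF that(1,2)] that(3) by linarith
  qed
  have "h T \<le> E"
  proof -
    have "h T \<le> K * (dist (\<gamma> (h T)) (\<gamma> 0) + C)"
      using qi_embedding_onD(5)[OF \<gamma>, of "h T" 0] h0[of T] by (simp add: dist_real_def)
    also have "dist (\<gamma> (h T)) (\<gamma> 0) \<le> M + 1" using h_near[of T] gT by metric
    finally show ?thesis using K by (simp add: E_def)
  qed
  moreover have "E < \<bar>h 0 - h T\<bar>" using T by (intro far) (auto simp: T_def)
  ultimately have start: "h T \<le> h 0" using h0[of 0] h0[of T] by linarith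
  obtain n :: nat where n: "K * (K * h 0 + 2 * C + 2) < real n" using reals_Archimedean2 by blast
  have "h 0 < h (T + real n)"
  proof -
    have "h 0 < \<bar>h (T + real n) - h 0\<bar>" using T n by (intro far) auto
    then show ?thesis using h0[of "T + real n"] h0[of 0] by linarith
  qed
  \<comment> \<open>At the first integer step after \<open>T\<close> at which \<open>h\<close>
    exceeds \<open>h 0\<close>, the previous value is at most \<open>h 0\<close>, so
    \<open>h\<close> lands within \<open>J\<close> of \<open>h 0\<close>. This time is at least
    \<open>T\<close> away from 0, where \<open>far\<close> demands a difference above
    \<open>J\<close>.\<close>
  then obtain k :: nat where k: "h 0 < h (T + real k)" "\<And>i. i < k \<Longrightarrow> h (T + real i) \<le> h 0"
    using exists_least_iff[of "\<lambda>k. h 0 < h (T + real k)"] by (metis not_le_imp_less)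
  have "k \<noteq> 0" using k(1) start by (intro notI) simp
  then have "h (T + real (k - 1)) \<le> h 0" by (intro k(2)) simp
  moreover have "\<bar>h (T + real k) - h (T + real (k - 1))\<bar> \<le> J"
    using T \<open>k \<noteq> 0\<close> by (intro upper) (auto simp: of_nat_diff)
  ultimately have "\<bar>h (T + real k) - h 0\<bar> \<le> J" using k(1) by linarith
  moreover have "J < \<bar>h (T + real k) - h 0\<bar>" using T by (intro far) (auto simp: T_def)
  ultimately show False by linarith
qed

lemma kappa_rays_zero:
  fixes \<phi> :: "'g \<Rightarrow> 'y::metric_space \<Rightarrow> 'y" and y0 :: 'y
  assumes "cobounded G \<phi>" "isometric_action G \<phi>" and zero: "\<And>t. 0 \<le> t \<Longrightarrow> \<kappa> t = 0"
  shows "kappa_rays \<kappa> y0 = {}"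
proof (rule ccontr)
  assume "kappa_rays \<kappa> y0 \<noteq> {}"
  then obtain \<gamma> where \<gamma>: "\<gamma> \<in> kappa_rays \<kappa> y0" by blast
  then obtain K C where q: "qi_embedding_on K C {0..} \<gamma>"
    by (auto simp: kappa_rays_def quasi_geodesic_ray_def)
  have Morse: "kappa_Morse \<kappa> y0 (\<gamma> ` {0..})" using \<gamma> by (simp add: kappa_rays_def)
  have "\<exists>t\<ge>0. dist y (\<gamma> t) \<le> 1" for y
  proof -
    obtain n where "infdist y (\<gamma> ` {0..}) \<le> n * \<kappa> (dist y0 y)"
      by (rule kappa_Morse_infdist[OF Morse, of "\<gamma> 0" y]) auto
    then have "infdist y (\<gamma> ` {0..}) < 1" by (simp add: zero)
    moreover have "1 \<le> infdist y (\<gamma> ` {0..})" if far: "\<not> (\<exists>t\<ge>0. dist y (\<gamma> t) \<le> 1)"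
    proof -
      have "1 \<le> dist y z" if "z \<in> \<gamma> ` {0..}" for z using that far by force
      then show ?thesis unfolding infdist_def by (auto intro: cINF_greatest)
    qed
    ultimately show ?thesis by fastforce
  qed
  moreover obtain M where
    "\<And>x y::'y. \<exists>h::'y \<Rightarrow> 'y. (\<forall>u v. dist (h u) (h v) = dist u v) \<and> dist (h x) y \<le> M"
    by (rule cobounded_transitive[OF assms(1,2)]) blast
  ultimately show False using no_coarsely_dense_ray[OF _ q] by blast
qed

section \<open>The case \<open>\<kappa> 0 = 0 < \<kappa> 1\<close>: passage to
  \<open>\<kappa> + 1\<close>\<close>

text \<open>If \<open>\<kappa> 0 = 0\<close> but \<open>\<kappa>\<close> is not identically zero, then being \<open>\<kappa>\<close>-Morse means being
  \<open>(\<kappa> + 1)\<close>-Morse and having the base point in the closure; concavity gives a linear lower bound for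
  \<open>\<kappa>\<close> near \<open>0\<close>.\<close>

lemma kappa_nbhd_add_one:
  assumes \<kappa>: "sublinear \<kappa>" "0 < \<kappa> 1" and base: "infdist y0 Z = 0" and "0 \<le> n"
  shows "kappa_nbhd (\<lambda>t. \<kappa> t + 1) y0 Z n \<subseteq> kappa_nbhd \<kappa> y0 Z (n * (1 + 1 / \<kappa> 1) + 1 / \<kappa> 1)"
proof
  fix y assume y: "y \<in> kappa_nbhd (\<lambda>t. \<kappa> t + 1) y0 Z n"
  define d where "d = dist y0 y"
  have d: "0 \<le> d" by (simp add: d_def)
  have \<kappa>d: "0 \<le> \<kappa> d" by (rule sublinear_nonneg[OF \<kappa>(1) d])
  show "y \<in> kappa_nbhd \<kappa> y0 Z (n * (1 + 1 / \<kappa> 1) + 1 / \<kappa> 1)"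
  proof (cases "d \<le> 1")
    case True
    \<comment> \<open>Near \<open>y0\<close> the \<open>(\<kappa> + 1)\<close>-bound on
      \<open>y\<close> is too weak; the base point in the closure of \<open>Z\<close> serves
      instead.\<close>
    have "infdist y Z \<le> d" using infdist_triangle[of y Z y0] base by (simp add: d_def dist_commute)
    also have "d \<le> \<kappa> d / \<kappa> 1"
      using sublinear_scale[OF \<kappa>(1) d True, of 1] \<kappa>(2) by (simp add: le_divide_eq)
    also have "\<dots> \<le> (n * (1 + 1 / \<kappa> 1) + 1 / \<kappa> 1) * \<kappa> d"
      using \<kappa>d \<kappa>(2) \<open>0 \<le> n\<close> by (simp add: distrib_right)
    finally show ?thesis by (simp add: kappa_nbhd_def d_def)
  next
    case False
    have "1 \<le> \<kappa> d / \<kappa> 1" using sublinear_mono[OF \<kappa>(1), of 1 d] False \<kappa>(2) by simp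
    then have "n * (\<kappa> d + 1) \<le> n * (\<kappa> d + \<kappa> d / \<kappa> 1)" using \<open>0 \<le> n\<close> by (intro mult_left_mono) auto
    also have "\<dots> \<le> (n * (1 + 1 / \<kappa> 1) + 1 / \<kappa> 1) * \<kappa> d"
      using \<kappa>d \<kappa>(2) by (simp add: algebra_simps)
    finally show ?thesis using y by (simp add: kappa_nbhd_def d_def)
  qed
qed

lemma kappa_nbhd_le_add_one: "0 \<le> n \<Longrightarrow> kappa_nbhd \<kappa> y0 Z n \<subseteq> kappa_nbhd (\<lambda>t. \<kappa> t + 1) y0 Z n"
  by (auto simp: kappa_nbhd_def distrib_left intro: order_trans)

lemma kappa_rays_add_one_iff:
  assumes \<kappa>: "sublinear \<kappa>" "\<kappa> 0 = 0" "0 < \<kappa> 1"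
  shows "\<gamma> \<in> kappa_rays \<kappa> y0 \<longleftrightarrow>
    \<gamma> \<in> kappa_rays (\<lambda>t. \<kappa> t + 1) y0 \<and> infdist y0 (\<gamma> ` {0..}) = 0"
proof safe
  assume \<gamma>: "\<gamma> \<in> kappa_rays \<kappa> y0"
  then have Morse: "kappa_Morse \<kappa> y0 (\<gamma> ` {0..})" by (simp add: kappa_rays_def)
  have "kappa_Morse (\<lambda>t. \<kappa> t + 1) y0 (\<gamma> ` {0..})"
    by (rule kappa_Morse_mono[OF Morse]) (use kappa_nbhd_le_add_one in blast)
  then show "\<gamma> \<in> kappa_rays (\<lambda>t. \<kappa> t + 1) y0" using \<gamma> by (simp add: kappa_rays_def)
  obtain n where "infdist y0 (\<gamma> ` {0..}) \<le> n * \<kappa> (dist y0 y0)"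
    by (rule kappa_Morse_infdist[OF Morse, of "\<gamma> 0" y0]) auto
  then show "infdist y0 (\<gamma> ` {0..}) = 0" using \<kappa>(2) infdist_nonneg[of y0 "\<gamma> ` {0..}"] by simp
next
  assume \<gamma>: "\<gamma> \<in> kappa_rays (\<lambda>t. \<kappa> t + 1) y0" and base: "infdist y0 (\<gamma> ` {0..}) = 0"
  then have Morse: "kappa_Morse (\<lambda>t. \<kappa> t + 1) y0 (\<gamma> ` {0..})" by (simp add: kappa_rays_def)
  have "kappa_Morse \<kappa> y0 (\<gamma> ` {0..})"
  proof (rule kappa_Morse_mono[OF Morse])
    fix n :: real assume "0 \<le> n"
    then show "\<exists>m\<ge>0. kappa_nbhd (\<lambda>t. \<kappa> t + 1) y0 (\<gamma> ` {0..}) n \<subseteq> kappa_nbhd \<kappa> y0 (\<gamma> ` {0..}) m"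
      using kappa_nbhd_add_one[OF \<kappa>(1,3) base] \<kappa>(3) by (intro exI[of _ "n * (1 + 1 / \<kappa> 1) + 1 / \<kappa> 1"]) simp
  qed
  then show "\<gamma> \<in> kappa_rays \<kappa> y0" using \<gamma> by (simp add: kappa_rays_def)
qed

lemma kappa_close_add_one_iff:
  assumes \<kappa>: "sublinear \<kappa>" "0 < \<kappa> 1"
    and base: "infdist y0 (\<gamma> ` {0..}) = 0" "infdist y0 (\<gamma>' ` {0..}) = 0"
  shows "kappa_close \<kappa> y0 \<gamma> \<gamma>' \<longleftrightarrow> kappa_close (\<lambda>t. \<kappa> t + 1) y0 \<gamma> \<gamma>'"
proof -
  have "(\<exists>n. A \<subseteq> kappa_nbhd \<kappa> y0 Z n) \<longleftrightarrow> (\<exists>n. A \<subseteq> kappa_nbhd (\<lambda>t. \<kappa> t + 1) y0 Z n)"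
    if Z: "infdist y0 Z = 0" for A Z
  proof
    assume "\<exists>n. A \<subseteq> kappa_nbhd \<kappa> y0 Z n"
    then obtain n where "A \<subseteq> kappa_nbhd \<kappa> y0 Z n" by blast
    also have "\<dots> \<subseteq> kappa_nbhd \<kappa> y0 Z (max n 0)" by (rule kappa_nbhd_mono[OF \<kappa>(1)]) simp
    also have "\<dots> \<subseteq> kappa_nbhd (\<lambda>t. \<kappa> t + 1) y0 Z (max n 0)" by (rule kappa_nbhd_le_add_one) simp
    finally show "\<exists>n. A \<subseteq> kappa_nbhd (\<lambda>t. \<kappa> t + 1) y0 Z n" by blast
  next
    assume "\<exists>n. A \<subseteq> kappa_nbhd (\<lambda>t. \<kappa> t + 1) y0 Z n"
    then obtain n where "A \<subseteq> kappa_nbhd (\<lambda>t. \<kappa> t + 1) y0 Z n" by blast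
    also have "\<dots> \<subseteq> kappa_nbhd (\<lambda>t. \<kappa> t + 1) y0 Z (max n 0)"
      by (rule kappa_nbhd_mono[OF sublinear_add_one[OF \<kappa>(1)]]) simp
    also have "\<dots> \<subseteq> kappa_nbhd \<kappa> y0 Z (max n 0 * (1 + 1 / \<kappa> 1) + 1 / \<kappa> 1)"
      by (rule kappa_nbhd_add_one[OF \<kappa> Z]) simp
    finally show "\<exists>n. A \<subseteq> kappa_nbhd \<kappa> y0 Z n" by blast
  qed
  from this[OF base(1)] this[OF base(2)] show ?thesis unfolding kappa_close_def by simp
qed

lemma kappa_injective_add_one_iff:
  fixes x0 :: "'x::metric_space"
  assumes \<kappa>: "sublinear \<kappa>" "\<kappa> 0 = 0" "0 < \<kappa> 1" and hyp: "hyperbolic_space TYPE('x)"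
  shows "kappa_injective \<kappa> y0 x0 p \<longleftrightarrow> kappa_injective (\<lambda>t. \<kappa> t + 1) y0 x0 p"
proof
  assume inj: "kappa_injective (\<lambda>t. \<kappa> t + 1) y0 x0 p"
  have rays: "\<gamma> \<in> kappa_rays (\<lambda>t. \<kappa> t + 1) y0" if "\<gamma> \<in> kappa_rays \<kappa> y0" for \<gamma>
    using that kappa_rays_add_one_iff[OF \<kappa>] by blast
  have close: "kappa_close \<kappa> y0 \<gamma> \<gamma>' \<longleftrightarrow> kappa_close (\<lambda>t. \<kappa> t + 1) y0 \<gamma> \<gamma>'"
    if "\<gamma> \<in> kappa_rays \<kappa> y0" "\<gamma>' \<in> kappa_rays \<kappa> y0" for \<gamma> \<gamma>'
    using that kappa_rays_add_one_iff[OF \<kappa>] kappa_close_add_one_iff[OF \<kappa>(1,3)] by blast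
  show "kappa_injective \<kappa> y0 x0 p"
    using inj rays close unfolding kappa_injective_def by simp
next
  assume inj: "kappa_injective \<kappa> y0 x0 p"
  let ?\<kappa>' = "\<lambda>t. \<kappa> t + 1"
  have \<kappa>': "sublinear ?\<kappa>'" "0 < ?\<kappa>' 0" using sublinear_add_one[OF \<kappa>(1)] \<kappa>(2) by simp_all
  \<comment> \<open>Rays need not be continuous, so resetting the value at time 0 is a bounded
    change. It puts \<open>y0\<close> on the image, which makes a
    \<open>(\<kappa> + 1)\<close>-Morse ray \<open>\<kappa>\<close>-Morse.\<close>
  define r where "r \<gamma> = \<gamma>(0 := y0)" for \<gamma> :: "real \<Rightarrow> _"
  have near: "dist (f (\<gamma> t)) (f (r \<gamma> t)) \<le> dist (f (\<gamma> 0)) (f y0)" for f :: "_ \<Rightarrow> 'c::metric_space" and \<gamma> t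
    by (simp add: r_def)
  have r_rays: "r \<gamma> \<in> kappa_rays ?\<kappa>' y0" if "\<gamma> \<in> kappa_rays ?\<kappa>' y0" for \<gamma>
    by (rule kappa_rays_quasi_isometry[OF \<kappa>' quasi_isometry_id that near])
  have base: "infdist y0 (r \<gamma> ` {0..}) = 0" for \<gamma>
  proof -
    have "r \<gamma> 0 = y0" by (simp add: r_def)
    then have "y0 \<in> r \<gamma> ` {0..}" by force
    then show ?thesis by (rule infdist_zero)
  qed
  have r_rays': "r \<gamma> \<in> kappa_rays \<kappa> y0" if "\<gamma> \<in> kappa_rays ?\<kappa>' y0" for \<gamma>
    using r_rays[OF that] base kappa_rays_add_one_iff[OF \<kappa>] by blast
  have r_close: "kappa_close ?\<kappa>' y0 \<gamma> \<gamma>' \<longleftrightarrow> kappa_close \<kappa> y0 (r \<gamma>) (r \<gamma>')" for \<gamma> \<gamma>'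
  proof -
    define M where "M = max (dist (\<gamma> 0) y0) (dist (\<gamma>' 0) y0)"
    have M: "dist (\<gamma> t) (r \<gamma> t) \<le> M" "dist (\<gamma>' t) (r \<gamma>' t) \<le> M" for t
      by (auto simp: r_def M_def le_max_iff_disj)
    have "kappa_close ?\<kappa>' y0 \<gamma> \<gamma>' \<longleftrightarrow> kappa_close ?\<kappa>' y0 (r \<gamma>) (r \<gamma>')"
      by (rule kappa_close_quasi_isometry_iff[OF \<kappa>' quasi_isometry_id M])
    then show ?thesis using kappa_close_add_one_iff[OF \<kappa>(1,3) base base] by blast
  qed
  have r_point: "defines_point x0 0 (p \<circ> r \<gamma>) \<xi> \<longleftrightarrow> defines_point x0 0 (p \<circ> \<gamma>) \<xi>" for \<gamma> \<xi>
  proof -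
    have *: "dist ((p \<circ> \<gamma>) t) ((p \<circ> r \<gamma>) t) \<le> dist (p (\<gamma> 0)) (p y0)" for t using near by simp
    then have **: "dist ((p \<circ> r \<gamma>) t) ((p \<circ> \<gamma>) t) \<le> dist (p (\<gamma> 0)) (p y0)" for t by (metis dist_commute)
    show ?thesis
    proof
      show "defines_point x0 0 (p \<circ> \<gamma>) \<xi>" if "defines_point x0 0 (p \<circ> r \<gamma>) \<xi>"
        by (rule defines_point_perturb[OF hyp that **])
      show "defines_point x0 0 (p \<circ> r \<gamma>) \<xi>" if "defines_point x0 0 (p \<circ> \<gamma>) \<xi>"
        by (rule defines_point_perturb[OF hyp that *])
    qed
  qed
  show "kappa_injective ?\<kappa>' y0 x0 p"
    using inj r_rays' unfolding kappa_injective_def by (metis r_close r_point)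
qed

section \<open>Quotients and pull-back topologies\<close>

lemma quotient_map_class:
  assumes eq: "equiv A R" "equiv B S" and F: "\<And>x. x \<in> A \<Longrightarrow> F x \<in> B"
    and rel: "\<And>x y. x \<in> A \<Longrightarrow> y \<in> A \<Longrightarrow> (x, y) \<in> R \<longleftrightarrow> (F x, F y) \<in> S" and a: "a \<in> A"
  shows "(THE c'. c' \<in> B // S \<and> (\<forall>x\<in>R `` {a}. F x \<in> c')) = S `` {F a}"
proof (rule the_equality)
  have "R `` {a} \<subseteq> A" using equiv_class_subset[OF eq(1)] eq(1) unfolding equiv_def refl_on_def by blast
  then show "S `` {F a} \<in> B // S \<and> (\<forall>x\<in>R `` {a}. F x \<in> S `` {F a})"
    using rel[OF a] F[OF a] by (blast intro: quotientI)
  fix c' assume c': "c' \<in> B // S \<and> (\<forall>x\<in>R `` {a}. F x \<in> c')"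
  then have "F a \<in> c'" using equiv_class_self[OF eq(1) a] by blast
  then show "c' = S `` {F a}"
    using c' equiv_class_eq_iff[OF eq(2)] by (metis Image_singleton_iff eq(2) quotientE)
qed

lemma bij_betw_quotient_map:
  assumes eq: "equiv A R" "equiv B S" and F: "\<And>x. x \<in> A \<Longrightarrow> F x \<in> B"
    and rel: "\<And>x y. x \<in> A \<Longrightarrow> y \<in> A \<Longrightarrow> (x, y) \<in> R \<longleftrightarrow> (F x, F y) \<in> S"
    and surj: "\<And>b. b \<in> B \<Longrightarrow> \<exists>a\<in>A. (F a, b) \<in> S"
  shows "bij_betw (\<lambda>c. THE c'. c' \<in> B // S \<and> (\<forall>x\<in>c. F x \<in> c')) (A // R) (B // S)"
    (is "bij_betw ?\<Theta> _ _")
proof -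
  have \<Theta>: "?\<Theta> (R `` {a}) = S `` {F a}" if "a \<in> A" for a
    by (rule quotient_map_class[OF eq F rel that])
  have "?\<Theta> ` (A // R) = B // S"
  proof
    show "?\<Theta> ` (A // R) \<subseteq> B // S"
    proof (rule image_subsetI)
      fix c assume "c \<in> A // R"
      then obtain a where a: "a \<in> A" "c = R `` {a}" by (rule quotientE)
      show "?\<Theta> c \<in> B // S" unfolding a(2) \<Theta>[OF a(1)] by (rule quotientI[OF F[OF a(1)]])
    qed
    show "B // S \<subseteq> ?\<Theta> ` (A // R)"
    proof
      fix d assume "d \<in> B // S"
      then obtain b where b: "b \<in> B" "d = S `` {b}" by (rule quotientE)
      then obtain a where a: "a \<in> A" "(F a, b) \<in> S" using surj by blast
      have "d = ?\<Theta> (R `` {a})" unfolding \<Theta>[OF a(1)] b(2) using equiv_class_eq[OF eq(2) a(2)] by simp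
      then show "d \<in> ?\<Theta> ` (A // R)" using quotientI[OF a(1)] by (rule image_eqI)
    qed
  qed
  moreover have "inj_on ?\<Theta> (A // R)"
  proof (rule inj_onI)
    fix c d assume cd: "c \<in> A // R" "d \<in> A // R" and eq': "?\<Theta> c = ?\<Theta> d"
    obtain a where a: "a \<in> A" "c = R `` {a}" using cd(1) by (rule quotientE)
    obtain b where b: "b \<in> A" "d = R `` {b}" using cd(2) by (rule quotientE)
    have "S `` {F a} = S `` {F b}" using eq' unfolding a(2) b(2) \<Theta>[OF a(1)] \<Theta>[OF b(1)] .
    then have "(F a, F b) \<in> S" using eq_equiv_class[OF _ eq(2) F[OF b(1)]] by blast
    then have "(a, b) \<in> R" using rel a(1) b(1) by blast
    then show "c = d" unfolding a(2) b(2) by (rule equiv_class_eq[OF eq(1)])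
  qed
  ultimately show ?thesis by (simp add: bij_betw_def)
qed

lemma homeomorphic_map_pullback:
  assumes \<Theta>: "bij_betw \<Theta> A A'" and H: "homeomorphic_map T T' H"
    and \<iota>: "\<And>a. a \<in> A \<Longrightarrow> \<iota> a \<in> topspace T" and comm: "\<And>a. a \<in> A \<Longrightarrow> \<iota>' (\<Theta> a) = H (\<iota> a)"
  shows "homeomorphic_map (pullback_topology A \<iota> T) (pullback_topology A' \<iota>' T') \<Theta>"
proof -
  have HT: "H ` topspace T = topspace T'" "inj_on H (topspace T)"
    using homeomorphic_imp_surjective_map[OF H] homeomorphic_imp_injective_map[OF H] by auto
  have top: "topspace (pullback_topology A \<iota> T) = A"
    using \<iota> by (auto simp: topspace_pullback_topology)
  have \<Theta>A: "\<Theta> ` A = A'" "inj_on \<Theta> A" using \<Theta> by (auto simp: bij_betw_def)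
  have top': "topspace (pullback_topology A' \<iota>' T') = A'"
    using \<iota> comm HT(1) \<Theta>A(1) by (auto simp: topspace_pullback_topology)
  have "continuous_map (pullback_topology A \<iota> T) (pullback_topology A' \<iota>' T') \<Theta>"
    unfolding continuous_map top top'
  proof (intro conjI allI impI)
    show "\<Theta> ` A \<subseteq> A'" using \<Theta>A by simp
    fix U assume "openin (pullback_topology A' \<iota>' T') U"
    then obtain V where V: "openin T' V" "U = \<iota>' -` V \<inter> A'" by (auto simp: openin_pullback_topology)
    have "openin T {x \<in> topspace T. H x \<in> V}"
      using homeomorphic_imp_continuous_map[OF H] V(1) by (rule openin_continuous_map_preimage)
    moreover have "{x \<in> A. \<Theta> x \<in> U} = \<iota> -` {x \<in> topspace T. H x \<in> V} \<inter> A"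
    proof -
      have "\<Theta> x \<in> U \<longleftrightarrow> H (\<iota> x) \<in> V" if "x \<in> A" for x
        using comm[OF that] V(2) \<Theta>A(1) that by auto
      then show ?thesis using \<iota> by auto
    qed
    ultimately show "openin (pullback_topology A \<iota> T) {x \<in> A. \<Theta> x \<in> U}"
      by (auto simp: openin_pullback_topology)
  qed
  moreover have "open_map (pullback_topology A \<iota> T) (pullback_topology A' \<iota>' T') \<Theta>"
    unfolding open_map_def
  proof (intro allI impI)
    fix U assume "openin (pullback_topology A \<iota> T) U"
    then obtain V where V: "openin T V" "U = \<iota> -` V \<inter> A" by (auto simp: openin_pullback_topology)
    have "openin T' (H ` V)" using homeomorphic_imp_open_map[OF H] V(1) by (simp add: open_map_def)
    moreover have "\<Theta> ` U = \<iota>' -` (H ` V) \<inter> A'"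
    proof
      show "\<Theta> ` U \<subseteq> \<iota>' -` (H ` V) \<inter> A'" using V(2) comm \<Theta>A(1) by auto
      show "\<iota>' -` (H ` V) \<inter> A' \<subseteq> \<Theta> ` U"
      proof
        fix b assume b: "b \<in> \<iota>' -` (H ` V) \<inter> A'"
        then obtain a v where a: "a \<in> A" "b = \<Theta> a" and v: "v \<in> V" "\<iota>' b = H v" using \<Theta>A(1) by blast
        then have "\<iota> a = v"
          using comm[OF a(1)] \<iota>[OF a(1)] inj_onD[OF HT(2)] openin_subset[OF V(1)] by auto
        then show "b \<in> \<Theta> ` U" using a v V(2) by blast
      qed
    qed
    ultimately show "openin (pullback_topology A' \<iota>' T') (\<Theta> ` U)"
      by (auto simp: openin_pullback_topology)
  qed
  ultimately show ?thesis
    by (intro bijective_open_imp_homeomorphic_map) (simp_all add: top top' \<Theta>A)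
qed


section \<open>The map between \<open>\<kappa>\<close>-boundaries\<close>

definition kappa_rel :: "(real \<Rightarrow> real) \<Rightarrow> 'a::metric_space \<Rightarrow> ((real \<Rightarrow> 'a) \<times> (real \<Rightarrow> 'a)) set" where
  "kappa_rel \<kappa> y0 = {(\<gamma>, \<gamma>'). \<gamma> \<in> kappa_rays \<kappa> y0 \<and> \<gamma>' \<in> kappa_rays \<kappa> y0 \<and> kappa_close \<kappa> y0 \<gamma> \<gamma>'}"

lemma kappa_boundary_altdef: "kappa_boundary \<kappa> y0 = kappa_rays \<kappa> y0 // kappa_rel \<kappa> y0"
  by (simp add: kappa_boundary_def kappa_rel_def)

lemma kappa_injective_rel_iff:
  fixes x0 :: "'x::metric_space"
  assumes inj: "kappa_injective \<kappa> y0 x0 p"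
  shows "(\<gamma>, \<gamma>') \<in> kappa_rel \<kappa> y0 \<longleftrightarrow> \<gamma> \<in> kappa_rays \<kappa> y0 \<and> \<gamma>' \<in> kappa_rays \<kappa> y0 \<and>
    (\<exists>\<xi>. defines_point x0 0 (p \<circ> \<gamma>) \<xi> \<and> defines_point x0 0 (p \<circ> \<gamma>') \<xi>)"
  using inj unfolding kappa_rel_def kappa_injective_def by blast

text \<open>Injectivity identifies closeness of Morse rays with having the same limit point, so
  transitivity is uniqueness of limit points and needs no estimate in \<open>Y\<close>.\<close>

lemma kappa_injective_equiv:
  fixes x0 :: "'x::metric_space"
  assumes hyp: "hyperbolic_space TYPE('x)" and inj: "kappa_injective \<kappa> y0 x0 p"
  shows "equiv (kappa_rays \<kappa> y0) (kappa_rel \<kappa> y0)"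
proof (rule equivI)
  note rel = kappa_injective_rel_iff[OF inj]
  show "kappa_rel \<kappa> y0 \<subseteq> kappa_rays \<kappa> y0 \<times> kappa_rays \<kappa> y0" by (auto simp: kappa_rel_def)
  show "refl_on (kappa_rays \<kappa> y0) (kappa_rel \<kappa> y0)"
    using inj unfolding refl_on_def rel kappa_injective_def by blast
  show "sym (kappa_rel \<kappa> y0)" unfolding sym_def rel by blast
  show "trans (kappa_rel \<kappa> y0)"
  proof (rule transI)
    fix \<alpha> \<beta> \<gamma> assume "(\<alpha>, \<beta>) \<in> kappa_rel \<kappa> y0" "(\<beta>, \<gamma>) \<in> kappa_rel \<kappa> y0"
    then show "(\<alpha>, \<gamma>) \<in> kappa_rel \<kappa> y0" unfolding rel using defines_point_unique[OF hyp] by metis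
  qed
qed

lemma boundary_projection_class:
  fixes x0 :: "'x::metric_space"
  assumes hyp: "hyperbolic_space TYPE('x)" and inj: "kappa_injective \<kappa> y0 x0 p"
    and \<gamma>: "\<gamma> \<in> kappa_rays \<kappa> y0"
  shows "defines_point x0 0 (p \<circ> \<gamma>) (boundary_projection x0 p (kappa_rel \<kappa> y0 `` {\<gamma>}))"
proof -
  obtain \<xi> where \<xi>: "defines_point x0 0 (p \<circ> \<gamma>) \<xi>"
    using inj \<gamma> unfolding kappa_injective_def by blast
  have "boundary_projection x0 p (kappa_rel \<kappa> y0 `` {\<gamma>}) = \<xi>"
    unfolding boundary_projection_def
  proof (rule the_equality)
    show "\<forall>\<gamma>'\<in>kappa_rel \<kappa> y0 `` {\<gamma>}. defines_point x0 0 (p \<circ> \<gamma>') \<xi>"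
    proof
      fix \<gamma>' assume "\<gamma>' \<in> kappa_rel \<kappa> y0 `` {\<gamma>}"
      then obtain \<eta> where \<eta>: "defines_point x0 0 (p \<circ> \<gamma>) \<eta>" "defines_point x0 0 (p \<circ> \<gamma>') \<eta>"
        unfolding Image_singleton_iff kappa_injective_rel_iff[OF inj] by blast
      then show "defines_point x0 0 (p \<circ> \<gamma>') \<xi>" using defines_point_unique[OF hyp \<eta>(1) \<xi>] by simp
    qed
    fix \<eta> assume "\<forall>\<gamma>'\<in>kappa_rel \<kappa> y0 `` {\<gamma>}. defines_point x0 0 (p \<circ> \<gamma>') \<eta>"
    then have "defines_point x0 0 (p \<circ> \<gamma>) \<eta>"
      using equiv_class_self[OF kappa_injective_equiv[OF hyp inj] \<gamma>] by blast
    then show "\<eta> = \<xi>" using defines_point_unique[OF hyp _ \<xi>] by blast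
  qed
  then show ?thesis using \<xi> by simp
qed

lemma defines_point_boundary_map:
  fixes x0 :: "'a::metric_space" and x0' :: "'b::metric_space"
  assumes hyp: "hyperbolic_space TYPE('a)" "hyperbolic_space TYPE('b)"
    and dom: "gromov_dominated x0 id x0' f" and c: "defines_point x0 0 c \<xi>"
  shows "defines_point x0' 0 (f \<circ> c) (boundary_map x0' f \<xi>)"
  unfolding defines_point_iff
proof (intro conjI allI impI)
  have \<xi>: "\<xi> \<in> gromov_boundary x0" and ct: "\<And>t. diverging_times t \<Longrightarrow> c \<circ> t \<in> \<xi>"
    using c by (auto simp: defines_point_iff)
  show "boundary_map x0' f \<xi> \<in> gromov_boundary x0'"
    by (rule boundary_map_class(1)[OF hyp dom \<xi> ct[OF diverging_times_real]])
  show "(f \<circ> c) \<circ> t \<in> boundary_map x0' f \<xi>" if "diverging_times t" for t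
    using boundary_map_class(2)[OF hyp dom \<xi> ct[OF that]] by (simp add: comp_assoc)
qed

lemma homeomorphic_map_kappa_boundary_map:
  fixes x0 :: "'a::metric_space" and x0' :: "'b::metric_space"
  assumes \<kappa>: "sublinear \<kappa>" "0 < \<kappa> 0"
    and a: "admits_quasi_ruling D TYPE('a)" "hyperbolic_space TYPE('a)"
    and b: "admits_quasi_ruling D' TYPE('b)" "hyperbolic_space TYPE('b)"
    and f: "quasi_isometry f" and \<Psi>: "quasi_isometry \<Psi>" and M: "\<And>y. dist (f (p y)) (p' (\<Psi> y)) \<le> M"
    and inj: "kappa_injective \<kappa> y0 x0 p" "kappa_injective \<kappa> y0' x0' p'"
  shows "homeomorphic_map (projection_topology \<kappa> y0 x0 p) (projection_topology \<kappa> y0' x0' p')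
    (kappa_boundary_map \<kappa> y0' \<Psi>)"
proof -
  note eq = kappa_injective_equiv[OF a(2) inj(1)] kappa_injective_equiv[OF b(2) inj(2)]
  have rays: "\<Psi> \<circ> \<gamma> \<in> kappa_rays \<kappa> y0'" if "\<gamma> \<in> kappa_rays \<kappa> y0" for \<gamma>
    by (rule kappa_rays_quasi_isometry[OF \<kappa> \<Psi> that, of _ 0]) simp
  have close: "kappa_close \<kappa> y0 \<gamma> \<gamma>' \<longleftrightarrow> kappa_close \<kappa> y0' (\<Psi> \<circ> \<gamma>) (\<Psi> \<circ> \<gamma>')" for \<gamma> \<gamma>'
    by (rule kappa_close_quasi_isometry_iff[OF \<kappa> \<Psi>, of _ _ 0]) simp_all
  have rel: "(\<gamma>, \<gamma>') \<in> kappa_rel \<kappa> y0 \<longleftrightarrow> (\<Psi> \<circ> \<gamma>, \<Psi> \<circ> \<gamma>') \<in> kappa_rel \<kappa> y0'"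
    if "\<gamma> \<in> kappa_rays \<kappa> y0" "\<gamma>' \<in> kappa_rays \<kappa> y0" for \<gamma> \<gamma>'
    using that rays close by (simp add: kappa_rel_def)
  have surj: "\<exists>\<gamma>\<in>kappa_rays \<kappa> y0. (\<Psi> \<circ> \<gamma>, \<gamma>') \<in> kappa_rel \<kappa> y0'" if \<gamma>': "\<gamma>' \<in> kappa_rays \<kappa> y0'" for \<gamma>'
  proof -
    obtain \<Phi> N where \<Phi>: "quasi_isometry \<Phi>"
      and N: "\<And>y. dist (\<Phi> (\<Psi> y)) y \<le> N" "\<And>y. dist (\<Psi> (\<Phi> y)) y \<le> N"
      by (rule quasi_isometry_inverse[OF \<Psi>]) blast
    have N0: "0 \<le> N" using N(1)[of y0] zero_le_dist[of "\<Phi> (\<Psi> y0)" y0] by linarith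
    have \<gamma>: "\<Phi> \<circ> \<gamma>' \<in> kappa_rays \<kappa> y0"
      by (rule kappa_rays_quasi_isometry[OF \<kappa> \<Phi> \<gamma>', of _ 0]) simp
    have "kappa_close \<kappa> y0' \<gamma>' \<gamma>'"
      using equiv_class_self[OF eq(2) \<gamma>'] by (simp add: kappa_rel_def)
    \<comment> \<open>Closeness of \<open>\<gamma>'\<close> to itself is perturbed in the first
      argument, using that \<open>\<Psi> \<circ> \<Phi>\<close> moves points by at most
      \<open>N\<close>.\<close>
    moreover have "kappa_close \<kappa> y0' \<gamma>' \<gamma>' \<longleftrightarrow> kappa_close \<kappa> y0' (\<Psi> \<circ> (\<Phi> \<circ> \<gamma>')) \<gamma>'"
      by (rule kappa_close_quasi_isometry_iff[OF \<kappa> quasi_isometry_id, of _ _ N])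
        (use N(2) N0 in \<open>simp_all add: dist_commute\<close>)
    ultimately show ?thesis using \<gamma> rays[OF \<gamma>] \<gamma>' by (auto simp: kappa_rel_def)
  qed
  have df: "gromov_dominated x0 id x0' f"
    by (rule quasi_isometry_gromov_dominated[OF f a b])
  have map_class: "kappa_boundary_map \<kappa> y0' \<Psi> (kappa_rel \<kappa> y0 `` {\<gamma>}) = kappa_rel \<kappa> y0' `` {\<Psi> \<circ> \<gamma>}"
    if "\<gamma> \<in> kappa_rays \<kappa> y0" for \<gamma>
    unfolding kappa_boundary_map_def kappa_boundary_altdef
    by (rule quotient_map_class[OF eq rays rel that])
  have repr: "\<exists>\<gamma>\<in>kappa_rays \<kappa> y0. c = kappa_rel \<kappa> y0 `` {\<gamma>}" if "c \<in> kappa_boundary \<kappa> y0" for c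
    using that unfolding kappa_boundary_altdef by (blast elim: quotientE)
  show ?thesis
    unfolding projection_topology_def
  proof (rule homeomorphic_map_pullback[OF _ homeomorphic_map_boundary_map[OF f a b]])
    show "bij_betw (kappa_boundary_map \<kappa> y0' \<Psi>) (kappa_boundary \<kappa> y0) (kappa_boundary \<kappa> y0')"
      unfolding kappa_boundary_map_def[abs_def] kappa_boundary_altdef
      by (rule bij_betw_quotient_map[OF eq rays rel surj])
    fix c assume "c \<in> kappa_boundary \<kappa> y0"
    then obtain \<gamma> where \<gamma>: "\<gamma> \<in> kappa_rays \<kappa> y0" "c = kappa_rel \<kappa> y0 `` {\<gamma>}" using repr by blast
    note point = boundary_projection_class[OF a(2) inj(1) \<gamma>(1)]
    then show "boundary_projection x0 p c \<in> topspace (visual_topology x0)"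
      by (simp add: topspace_visual_topology defines_point_iff \<gamma>(2))
    \<comment> \<open>The path \<open>f \<circ> p \<circ> \<gamma>\<close> has this limit by
      \<open>defines_point_boundary_map\<close>, and
      \<open>p' \<circ> \<Psi> \<circ> \<gamma>\<close> stays within \<open>M\<close> of it. This is
      the commuting square on one class.\<close>
    have "defines_point x0' 0 (p' \<circ> (\<Psi> \<circ> \<gamma>)) (boundary_map x0' f (boundary_projection x0 p c))"
      by (rule defines_point_perturb[OF b(2) defines_point_boundary_map[OF a(2) b(2) df point], of _ M,
          folded \<gamma>(2)]) (simp add: M)
    then show "boundary_projection x0' p' (kappa_boundary_map \<kappa> y0' \<Psi> c) =
        boundary_map x0' f (boundary_projection x0 p c)"
      unfolding \<gamma>(2) map_class[OF \<gamma>(1)]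
      using defines_point_unique[OF b(2) boundary_projection_class[OF b(2) inj(2) rays[OF \<gamma>(1)]]] by blast
  qed
qed

text \<open>Injectivity pulls back along a quasi-isometry, so one direction uses
  \<open>\<Psi>\<close> and the other its coarse inverse \<open>\<Phi>\<close>. For the latter,
  \<open>p \<circ> \<Phi>\<close> is comparable with \<open>p'\<close>, because
  \<open>p' \<circ> \<Psi> \<circ> \<Phi>\<close> is at bounded distance from
  \<open>p'\<close>.\<close>

lemma kappa_injective_quasi_isometry_iff:
  fixes x0 :: "'a::metric_space" and x0' :: "'b::metric_space"
  assumes \<kappa>: "sublinear \<kappa>" "0 < \<kappa> 0"
    and hyp: "hyperbolic_space TYPE('a)" "hyperbolic_space TYPE('b)"
    and \<Psi>: "quasi_isometry \<Psi>" and p': "coarsely_Lipschitz p'"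
    and dom: "gromov_dominated x0 p x0' (p' \<circ> \<Psi>)" "gromov_dominated x0' (p' \<circ> \<Psi>) x0 p"
  shows "kappa_injective \<kappa> y0 x0 p \<longleftrightarrow> kappa_injective \<kappa> y0' x0' p'"
proof
  show "kappa_injective \<kappa> y0 x0 p" if "kappa_injective \<kappa> y0' x0' p'"
    by (rule kappa_injective_dominated[OF hyp(2,1) dom(2,1)
        kappa_injective_comp_quasi_isometry[OF \<kappa> \<Psi> that]])
  assume inj: "kappa_injective \<kappa> y0 x0 p"
  obtain \<Phi> N where \<Phi>: "quasi_isometry \<Phi>"
    and N: "\<And>y. dist (\<Phi> (\<Psi> y)) y \<le> N" "\<And>y. dist (\<Psi> (\<Phi> y)) y \<le> N"
    by (rule quasi_isometry_inverse[OF \<Psi>]) blast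
  obtain B where B: "\<And>x y. dist x y \<le> N \<Longrightarrow> dist (p' x) (p' y) \<le> B"
    by (rule coarsely_Lipschitz_bound[OF p', of N]) blast
  have "gromov_dominated x0' (p' \<circ> \<Psi> \<circ> \<Phi>) x0' p'" "gromov_dominated x0' p' x0' (p' \<circ> \<Psi> \<circ> \<Phi>)"
    using B N(2) by (auto intro!: gromov_dominated_perturb[of _ _ B] simp: dist_commute)
  then have "gromov_dominated x0 (p \<circ> \<Phi>) x0' p'" "gromov_dominated x0' p' x0 (p \<circ> \<Phi>)"
    using gromov_dominated_comp[OF dom(1), of \<Phi>] gromov_dominated_comp[OF dom(2), of \<Phi>]
    by (auto intro: gromov_dominated_trans)
  then show "kappa_injective \<kappa> y0' x0' p'"
    by (rule kappa_injective_dominated[OF hyp _ _ kappa_injective_comp_quasi_isometry[OF \<kappa> \<Phi> inj]])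
qed

theorem lemma2:
  fixes \<kappa> :: "real \<Rightarrow> real"
    and G :: "('g, 'm) monoid_scheme"
    and \<phi> :: "'g \<Rightarrow> 'y::metric_space \<Rightarrow> 'y"
    and \<psi> :: "'g \<Rightarrow> 'x::metric_space \<Rightarrow> 'x"
    and \<phi>' :: "'g \<Rightarrow> 'y'::metric_space \<Rightarrow> 'y'"
    and \<psi>' :: "'g \<Rightarrow> 'x'::metric_space \<Rightarrow> 'x'"
    and p :: "'y \<Rightarrow> 'x" and p' :: "'y' \<Rightarrow> 'x'"
    and \<Psi> :: "'y \<Rightarrow> 'y'"
    and y0 :: 'y and y0' :: 'y' and x0 :: 'x and x0' :: 'x'
  assumes "sublinear \<kappa>"
    and "hyperbolic_projection G \<phi> \<psi>" and "induced_projection G \<phi> \<psi> p"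
    and "hyperbolic_projection G \<phi>' \<psi>'" and "induced_projection G \<phi>' \<psi>' p'"
    and "equivalent_actions G \<psi> \<psi>'"
    and "coarsely_equivariant G \<phi> \<phi>' \<Psi>" and "quasi_isometry \<Psi>"
  shows "(kappa_injective \<kappa> y0 x0 p \<longleftrightarrow> kappa_injective \<kappa> y0' x0' p') \<and>
    (0 < \<kappa> 0 \<longrightarrow> kappa_injective \<kappa> y0 x0 p \<and> kappa_injective \<kappa> y0' x0' p' \<longrightarrow>
       homeomorphic_map (projection_topology \<kappa> y0 x0 p) (projection_topology \<kappa> y0' x0' p')
         (kappa_boundary_map \<kappa> y0' \<Psi>))"
proof -
  have hyp: "hyperbolic_space TYPE('x)" "hyperbolic_space TYPE('x')"
    and cob: "cobounded G \<phi>" "cobounded G \<phi>'"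
    and act: "isometric_action G \<phi>" "isometric_action G \<phi>'" "isometric_action G \<psi>'"
    using assms(2,4) cocompact_imp_cobounded
    by (auto simp: hyperbolic_projection_def geometric_action_def)
  obtain D D' where D: "admits_quasi_ruling D TYPE('x)" and D': "admits_quasi_ruling D' TYPE('x')"
    using assms(2,4) by (auto simp: hyperbolic_projection_def)
  have p: "coarsely_equivariant G \<phi> \<psi> p" "coarsely_Lipschitz p"
    and p': "coarsely_equivariant G \<phi>' \<psi>' p'" "coarsely_Lipschitz p'"
    using assms(3,5) by (auto simp: induced_projection_def)
  obtain f where f: "coarsely_equivariant G \<psi> \<psi>' f" "quasi_isometry f"
    using assms(6) by (auto simp: equivalent_actions_def)
  note lip = quasi_isometry_imp_coarsely_Lipschitz
  obtain M where "\<And>y. dist ((f \<circ> p) y) ((p' \<circ> \<Psi>) y) \<le> M"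
    by (rule coarsely_equivariant_bounded_distance[OF cob(1) act(3)
        coarsely_equivariant_comp[OF p(1) f(1) lip[OF f(2)]] coarsely_Lipschitz_comp[OF p(2) lip[OF f(2)]]
        coarsely_equivariant_comp[OF assms(7) p'] coarsely_Lipschitz_comp[OF lip[OF assms(8)] p'(2)]]) blast
  then have M: "dist (f (p y)) (p' (\<Psi> y)) \<le> M" for y by simp
  have df: "gromov_dominated x0 id x0' f" "gromov_dominated x0' f x0 id"
    by (rule quasi_isometry_gromov_dominated[OF f(2) D hyp(1) D' hyp(2)])+
  have dom: "gromov_dominated x0 p x0' (p' \<circ> \<Psi>)" "gromov_dominated x0' (p' \<circ> \<Psi>) x0 p"
  proof -
    have "gromov_dominated x0' (f \<circ> p) x0' (p' \<circ> \<Psi>)" "gromov_dominated x0' (p' \<circ> \<Psi>) x0' (f \<circ> p)"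
      using M by (auto intro!: gromov_dominated_perturb[of _ _ M] simp: dist_commute)
    moreover have "gromov_dominated x0 p x0' (f \<circ> p)" "gromov_dominated x0' (f \<circ> p) x0 p"
      using gromov_dominated_comp[OF df(1), where h = p] gromov_dominated_comp[OF df(2), where h = p] by auto
    ultimately show "gromov_dominated x0 p x0' (p' \<circ> \<Psi>)" "gromov_dominated x0' (p' \<circ> \<Psi>) x0 p"
      by (auto intro: gromov_dominated_trans)
  qed
  note iff = kappa_injective_quasi_isometry_iff[OF _ _ hyp assms(8) p'(2) dom]
  have "kappa_injective \<kappa> y0 x0 p \<longleftrightarrow> kappa_injective \<kappa> y0' x0' p'"
  proof -
    \<comment> \<open>The cases are exhaustive: \<open>\<kappa> 1 = 0\<close> forces
      \<open>\<kappa> = 0\<close> on \<open>[0, 1]\<close> by monotonicity and beyond 1 by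
      concavity, which gives \<open>\<kappa> t / t \<le> \<kappa> 1\<close>.\<close>
    consider "0 < \<kappa> 0" | "\<kappa> 0 = 0" "0 < \<kappa> 1" | "\<And>t. 0 \<le> t \<Longrightarrow> \<kappa> t = 0"
    proof (cases "0 < \<kappa> 1")
      case True
      then show ?thesis using that(1,2) sublinear_nonneg[OF assms(1), of 0] by fastforce
    next
      case False
      have "\<kappa> t = 0" if t: "0 \<le> t" for t
      proof (cases "t \<le> 1")
        case True
        then show ?thesis
          using sublinear_mono[OF assms(1) t True] sublinear_nonneg[OF assms(1) t] False by linarith
      next
        case t1: False
        have "1 / t * \<kappa> t \<le> \<kappa> (1 / t * t)" using t1 by (intro sublinear_scale[OF assms(1)]) auto
        then have "\<kappa> t / t \<le> 0" using t1 False by simp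
        then show ?thesis using sublinear_nonneg[OF assms(1) t] t1 by (simp add: divide_le_0_iff)
      qed
      then show ?thesis using that(3) by blast
    qed
    then show ?thesis
    proof cases
      case 1
      then show ?thesis using iff[OF assms(1)] by blast
    next
      case 2
      then show ?thesis
        unfolding kappa_injective_add_one_iff[OF assms(1) 2 hyp(1)] kappa_injective_add_one_iff[OF assms(1) 2 hyp(2)]
        by (intro iff[OF sublinear_add_one[OF assms(1)]]) simp
    next
      case 3
      then show ?thesis
        using kappa_rays_zero[OF cob(1) act(1) 3] kappa_rays_zero[OF cob(2) act(2) 3]
        by (simp add: kappa_injective_def)
    qed
  qed
  moreover have "homeomorphic_map (projection_topology \<kappa> y0 x0 p) (projection_topology \<kappa> y0' x0' p')
      (kappa_boundary_map \<kappa> y0' \<Psi>)"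
    if "0 < \<kappa> 0" "kappa_injective \<kappa> y0 x0 p" "kappa_injective \<kappa> y0' x0' p'"
    by (rule homeomorphic_map_kappa_boundary_map[OF assms(1) that(1) D hyp(1) D' hyp(2) f(2) assms(8) M that(2,3)])
  ultimately show ?thesis by blast
qed

end
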